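(* Let $F\colon Q^\Delta\to Q^{\Delta'}$ be one of the weighted foldings in the context, with exchange matrices $S$ (of $Q^\Delta$) and $B'$ (of $Q^{\Delta'}$). Let $[k_1],\dots,[k_l]$ be any finite sequence of vertices of $Q^{\Delta'}$. Let $C'$ be the $C$-matrix obtained from $\binom{B'}{I}$ by the mutations $\mu_{[k_1]},\dots,\mu_{[k_l]}$ applied successively, and let $C$ be the $C$-matrix obtained from $\binom{S}{I}$ by the composite mutations $\hat\mu_{[k_1]},\dots,\hat\mu_{[k_l]}$ applied successively. Put $G=(C^T)^{-1}$ and $G'=(C'^T)^{-1}$. Then $$\mathbf d_F(C)=C'\qquad\text{and}\qquad \mathbf d_F(G)=G'.$$ Consequently, $\mathbf d_F$ intertwines composite mutation $\hat\mu_{[k]}$ of $C$- and $G$-matrices of $Q^\Delta$ with mutation $\mu_{[k]}$ of $C$- and $G$-matrices of $Q^{\Delta'}$, and with the map $X\mapsto(X^T)^{-1}$.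
   Context: Foldings: (I) $n\ge2$, $Q^{A_{2n}}$ on vertices $0..2n-1$ with one arrow between $i$ and $i+1$, even vertices all sources (or all sinks), vertex weights $\kappa(i)=U_i(\cos\frac{\pi}{2n+1})$ ($U_k$ Chebyshev of the second kind, $U_k(\cos\alpha)\sin\alpha=\sin(k+1)\alpha$); $Q^{I_2(2n+1)}$ has vertices $[0],[1]$ and one arrow of weight $2\cos\frac{\pi}{2n+1}$ oriented as the arrows from even to odd vertices; $F(i)=[i\bmod 2]$. (H) $m\in\{3,4\}$, $Q^\Delta$ of type $D_6$ ($m=3$) or $E_8$ ($m=4$) on vertices $1..m,\phi_1..\phi_m$, edges $i-(i+1)$, $\phi_i-\phi_{i+1}$ ($i\le m-2$), $(m-1)-\phi_m$, $\phi_{m-1}-m$, $\phi_{m-1}-\phi_m$, all edges between consecutive columns $\{i,\phi_i\},\{i+1,\phi_{i+1}\}$ oriented the same way; $\kappa(i)=1$, $\kappa(\phi_i)=2\cos\frac\pi5$; $Q^{H_m}$ the path $[1]-\cdots-[m]$, weights $1$ except $2\cos\frac\pi5$ on $[m-1]-[m]$, oriented as in $Q^\Delta$; $F(i)=F(\phi_i)=[i]$. In each fibre of $F$ there is exactly one vertex of weight $1$. Exchange matrix of a weighted quiver: $b_{ij}$ = weight of arrow $i\to j$, minus weight of $j\to i$, $0$ otherwise. Mutation $\mu_k$ of $\tilde B=\binom{B}{C}$ ($2N\times N$): $b'_{ij}=-b_{ij}$ if $i=k$ or $j=k$, otherwise $b'_{ij}=b_{ij}+\frac{|b_{ik}|b_{kj}+b_{ik}|b_{kj}|}{2}$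 (for all rows $i$). The lower half after a sequence of mutations starting from $\binom{B}{I}$ is the $C$-matrix. Composite mutation $\hat\mu_{[k]}=\prod_{v:F(v)=[k]}\mu_v$ (these mutations commute). $d_F\colon\mathbb Z^{Q^\Delta_0}\to\mathbb R^{Q^{\Delta'}_0}$, $d_F(v)_{[i]}=\sum_{F(j)=[i]}\kappa(j)v_j$. For a square matrix $X$ indexed by $Q^\Delta_0$ with columns $\mathbf v_j$, $\mathbf d_F(X)$ is the square matrix indexed by $Q^{\Delta'}_0$ whose $[j]$-th column is $d_F(\mathbf v_j)$, where $j$ is the unique vertex with $F(j)=[j]$ and $\kappa(j)=1$. *)

theory Defs
  imports Complex_Main "Jordan_Normal_Form.Gauss_Jordan_Elimination"
begin

fun chebU :: "nat \<Rightarrow> real \<Rightarrow> real" where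
  "chebU 0 x = 1"
| "chebU (Suc 0) x = 2 * x"
| "chebU (Suc (Suc k)) x = 2 * x * chebU (Suc k) x - chebU k x"

text \<open>Vertices are encoded by natural numbers.
  (I): vertices of Q^A_{2n} are 0..2n-1; vertices [0],[1] of Q^{I_2(2n+1)} are 0,1.
       The Boolean parameter is True iff the even vertices are sources.
  (H): vertex i (1 \<le> i \<le> m) is encoded as i-1, vertex phi_i as m+i-1;
       vertex [i] of Q^{H_m} is encoded as i-1.  The parameter ori c (0 \<le> c \<le> m-2)
       is True iff the edges between columns c+1 and c+2 (1-based) point from
       column c+1 to column c+2.\<close>

datatype folding = FoldI nat bool | FoldH nat "nat \<Rightarrow> bool"

definition valid_folding :: "folding \<Rightarrow> bool" where
  "valid_folding fd = (case fd of FoldI n s \<Rightarrow> n \<ge> 2 | FoldH m ori \<Rightarrow> m \<in> {3, 4})"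

fun fN :: "folding \<Rightarrow> nat" where
  "fN (FoldI n s) = 2 * n"
| "fN (FoldH m ori) = 2 * m"

fun fN' :: "folding \<Rightarrow> nat" where
  "fN' (FoldI n s) = 2"
| "fN' (FoldH m ori) = m"

fun fF :: "folding \<Rightarrow> nat \<Rightarrow> nat" where
  "fF (FoldI n s) v = v mod 2"
| "fF (FoldH m ori) v = v mod m"

fun fkappa :: "folding \<Rightarrow> nat \<Rightarrow> real" where
  "fkappa (FoldI n s) v = chebU v (cos (pi / real (2 * n + 1)))"
| "fkappa (FoldH m ori) v = (if v < m then 1 else 2 * cos (pi / 5))"

text \<open>undirected edges of the D6 / E8 diagram, written (a,b) with a in column c
  and b in column c+1 (columns 0-based: column of v is v mod m)\<close>
definition H_edge :: "nat \<Rightarrow> nat \<Rightarrow> nat \<Rightarrow> bool" where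
  "H_edge m a b =
     ((\<exists>c. c + 3 \<le> m \<and> a = c \<and> b = c + 1)
    \<or> (\<exists>c. c + 3 \<le> m \<and> a = m + c \<and> b = m + c + 1)
    \<or> (a = m - 2 \<and> b = 2 * m - 1)
    \<or> (a = 2 * m - 2 \<and> b = m - 1)
    \<or> (a = 2 * m - 2 \<and> b = 2 * m - 1))"

fun fS :: "folding \<Rightarrow> nat \<Rightarrow> nat \<Rightarrow> real" where
  "fS (FoldI n s) a b =
     (if a < 2 * n \<and> b < 2 * n \<and> (b = a + 1 \<or> a = b + 1)
      then (if even a = s then 1 else -1) else 0)"
| "fS (FoldH m ori) a b =
     (if H_edge m a b then (if ori (a mod m) then 1 else -1)
      else if H_edge m b a then (if ori (b mod m) then -1 else 1)
      else 0)"

definition H_weight :: "nat \<Rightarrow> nat \<Rightarrow> real" where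
  "H_weight m c = (if c + 2 = m then 2 * cos (pi / 5) else 1)"

fun fB' :: "folding \<Rightarrow> nat \<Rightarrow> nat \<Rightarrow> real" where
  "fB' (FoldI n s) a b =
     (let w = 2 * cos (pi / real (2 * n + 1)) in
      if a = 0 \<and> b = 1 then (if s then w else - w)
      else if a = 1 \<and> b = 0 then (if s then - w else w)
      else 0)"
| "fB' (FoldH m ori) a b =
     (if b = a + 1 \<and> b < m then (if ori a then H_weight m a else - H_weight m a)
      else if a = b + 1 \<and> a < m then (if ori b then - H_weight m b else H_weight m b)
      else 0)"

definition mutate :: "nat \<Rightarrow> real mat \<Rightarrow> real mat" where
  "mutate k M = mat (dim_row M) (dim_col M) (\<lambda>(i, j).
     if i = k \<or> j = k then - M $$ (i, j)
     else M $$ (i, j) + (\<bar>M $$ (i, k)\<bar> * M $$ (k, j) + M $$ (i, k) * \<bar>M $$ (k, j)\<bar>) / 2)"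

definition ext_init :: "nat \<Rightarrow> (nat \<Rightarrow> nat \<Rightarrow> real) \<Rightarrow> real mat" where
  "ext_init N B = mat (2 * N) N (\<lambda>(i, j).
     if i < N then B i j else (if i - N = j then 1 else 0))"

definition lower_half :: "nat \<Rightarrow> real mat \<Rightarrow> real mat" where
  "lower_half N M = mat N N (\<lambda>(i, j). M $$ (N + i, j))"

text \<open>Composite mutation: product of mu_v over all v with F v = k (they commute;
  we apply them in increasing order of v).\<close>
definition comp_mutate :: "nat \<Rightarrow> (nat \<Rightarrow> nat) \<Rightarrow> nat \<Rightarrow> real mat \<Rightarrow> real mat" where
  "comp_mutate N F k M = fold mutate (filter (\<lambda>v. F v = k) [0..<N]) M"

definition C_Delta :: "folding \<Rightarrow> nat list \<Rightarrow> real mat" where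
  "C_Delta fd ks = lower_half (fN fd)
     (fold (comp_mutate (fN fd) (fF fd)) ks (ext_init (fN fd) (fS fd)))"

definition C_Delta' :: "folding \<Rightarrow> nat list \<Rightarrow> real mat" where
  "C_Delta' fd ks = lower_half (fN' fd) (fold mutate ks (ext_init (fN' fd) (fB' fd)))"

definition rep_vertex :: "folding \<Rightarrow> nat \<Rightarrow> nat" where
  "rep_vertex fd b = (THE j. j < fN fd \<and> fF fd j = b \<and> fkappa fd j = 1)"

definition dF_vec :: "folding \<Rightarrow> (nat \<Rightarrow> real) \<Rightarrow> nat \<Rightarrow> real" where
  "dF_vec fd v a = (\<Sum>j \<in> {j. j < fN fd \<and> fF fd j = a}. fkappa fd j * v j)"

definition dF_mat :: "folding \<Rightarrow> real mat \<Rightarrow> real mat" where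
  "dF_mat fd X = mat (fN' fd) (fN' fd) (\<lambda>(a, b).
     dF_vec fd (\<lambda>l. X $$ (l, rep_vertex fd b)) a)"

end

theory Submission
  imports Defs "Jordan_Normal_Form.Determinant" "HOL-Library.Multiset"
begin

text \<open>The matrices of both quivers are compared through two relations, one summing over the rows of a
  fibre with weights \<open>\<kappa>\<close> and one, its transpose, summing over the columns.  Both survive a composite
  mutation as soon as all entries of a block (a pair of fibres) have the sign of the corresponding
  entry downstairs.  The row relation gives \<open>d\<^sub>F(C) = C'\<close>; the column relation says
  \<open>D C\<^sup>T = C'\<^sup>T D\<close> for the matrix \<open>D\<close> of \<open>d\<^sub>F\<close>, hence \<open>D G = G' D\<close>.  So only sign coherence is
  left.  For \<open>A\<^sub>2\<^sub>n\<close> the \<open>C\<close>-matrices are explicit: their columns are, up to sign, those of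
  \<open>U\<^sub>x + U\<^sub>x\<^sub>-\<^sub>1\<close> evaluated at half the adjacency matrix of the path, which are nonnegative.  For
  \<open>H\<^sub>3\<close> and \<open>H\<^sub>4\<close> the finitely many (32 and 280) seeds with coefficients in \<open>\<int>[\<phi>]\<close> are enumerated;
  every entry is \<open>\<plusminus>(a + b\<phi>)\<close> with \<open>a, b \<ge> 0\<close>, and irrationality of \<open>\<phi>\<close> recovers the integral block
  upstairs from it.\<close>

section \<open>Composite mutation and weighted foldings\<close>

text \<open>The obstacle is the absolute value in the mutation rule: a weighted sum over a fibre
  does not pass through it. Agreement of signs on a block turns every absolute value into
  multiplication by one sign that is read off downstairs. Both mutations then become the same
  bilinear expression with the same coefficient, and weighted sums pass through bilinear
  expressions. The sign information flows in opposite directions in the two types. For the path it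
  is available upstairs for every \<open>n\<close>: a composite mutation merely reverses the
  bipartite quiver, so the columns of \<open>C\<close> obey the three-term Chebyshev recurrence, and
  positive weights carry the signs downstairs. For H3 and H4 the small matrices downstairs are
  searched, and integrality carries the signs upstairs. The matrices \<open>G\<close> also require
  \<open>C\<close> to be invertible; this persists because mutation multiplies \<open>C\<close> on
  the right by an involution.\<close>

definition mut_step ::
    "nat set \<Rightarrow> nat set \<Rightarrow> (nat \<Rightarrow> nat \<Rightarrow> real) \<Rightarrow> (nat \<Rightarrow> nat \<Rightarrow> real) \<Rightarrow> nat \<Rightarrow> nat \<Rightarrow> real" where
  "mut_step R K t l i j =
     (if i \<in> R \<or> j \<in> K then - l i j
      else l i j + (\<Sum>k\<in>K. (\<bar>l i k\<bar> * t k j + l i k * \<bar>t k j\<bar>) / 2))"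

text \<open>\<open>t\<close> is the exchange matrix and \<open>l\<close> the
  \<open>C\<close>-matrix, taken as functions so that fibres can be summed over. The upper half is
  mutated with \<open>R = K\<close>, the lower half with \<open>R = {}\<close>, since none of its
  rows belongs to a mutated vertex.\<close>

definition represents :: "nat \<Rightarrow> real mat \<Rightarrow> (nat \<Rightarrow> nat \<Rightarrow> real) \<Rightarrow> (nat \<Rightarrow> nat \<Rightarrow> real) \<Rightarrow> bool" where
  "represents N M t l \<longleftrightarrow> dim_row M = 2 * N \<and> dim_col M = N \<and>
     (\<forall>i<N. \<forall>j<N. M $$ (i, j) = t i j \<and> M $$ (N + i, j) = l i j)"

lemma mutate_index:
  assumes "i < dim_row M" "j < dim_col M"
  shows "mutate k M $$ (i, j) = (if i = k \<or> j = k then - M $$ (i, j)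
     else M $$ (i, j) + (\<bar>M $$ (i, k)\<bar> * M $$ (k, j) + M $$ (i, k) * \<bar>M $$ (k, j)\<bar>) / 2)"
  using assms by (simp add: mutate_def)

text \<open>Since the block of \<open>M\<close> on \<open>vs\<close> vanishes, one mutation leaves
  the rows and columns of the remaining vertices unchanged up to sign. Later mutations thus read the
  original entries, and the corrections add up.\<close>

lemma fold_mutate_commuting:
  assumes "dim_row M = 2 * N" "dim_col M = N" "distinct vs" "set vs \<subseteq> {..<N}"
    and "\<And>v w. v \<in> set vs \<Longrightarrow> w \<in> set vs \<Longrightarrow> M $$ (v, w) = 0"
  shows "dim_row (fold mutate vs M) = 2 * N \<and> dim_col (fold mutate vs M) = N \<and>
    (\<forall>i<2*N. \<forall>j<N. fold mutate vs M $$ (i, j) =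
       mut_step (set vs) (set vs) (\<lambda>i j. M $$ (i, j)) (\<lambda>i j. M $$ (i, j)) i j)"
  using assms
proof (induction vs arbitrary: M)
  case Nil
  then show ?case by (simp add: mut_step_def)
next
  case (Cons v vs)
  let ?M = "mutate v M"
  have v: "v < N" "v \<notin> set vs" "M $$ (v, v) = 0"
    using Cons.prems by auto
  have dims: "dim_row ?M = 2 * N" "dim_col ?M = N"
    using Cons.prems(1,2) by (simp_all add: mutate_def)
  have idx: "?M $$ (i, j) = (if i = v \<or> j = v then - M $$ (i, j)
     else M $$ (i, j) + (\<bar>M $$ (i, v)\<bar> * M $$ (v, j) + M $$ (i, v) * \<bar>M $$ (v, j)\<bar>) / 2)"
    if "i < 2 * N" "j < N" for i j
    using that Cons.prems(1,2) by (simp add: mutate_index)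
  have lt: "w < N" "w < 2 * N" if "w \<in> set vs" for w
    using that Cons.prems(4) by auto
  have colK: "?M $$ (i, w) = (if i = v then - M $$ (i, w) else M $$ (i, w))"
    if "w \<in> set vs" "i < 2 * N" for i w
    using that v lt[of w] Cons.prems(5)[of v w] idx[of i w] by auto
  have rowK: "?M $$ (w, j) = (if j = v then - M $$ (w, j) else M $$ (w, j))"
    if "w \<in> set vs" "j < N" for j w
    using that v lt[of w] Cons.prems(5)[of w v] idx[of w j] by auto
  have zero: "?M $$ (a, b) = 0" if "a \<in> set vs" "b \<in> set vs" for a b
    using that rowK[of a b] lt Cons.prems(5)[of a b] v by auto
  have IH: "dim_row (fold mutate vs ?M) = 2 * N \<and> dim_col (fold mutate vs ?M) = N \<and>
    (\<forall>i<2*N. \<forall>j<N. fold mutate vs ?M $$ (i, j) =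
       mut_step (set vs) (set vs) (\<lambda>i j. ?M $$ (i, j)) (\<lambda>i j. ?M $$ (i, j)) i j)"
    using Cons.prems dims zero by (intro Cons.IH) auto
  have "mut_step (set vs) (set vs) (\<lambda>i j. ?M $$ (i, j)) (\<lambda>i j. ?M $$ (i, j)) i j =
        mut_step (set (v # vs)) (set (v # vs)) (\<lambda>i j. M $$ (i, j)) (\<lambda>i j. M $$ (i, j)) i j"
    if ij: "i < 2 * N" "j < N" for i j
  proof (cases "i \<in> set vs \<or> j \<in> set vs")
    case True
    then have "?M $$ (i, j) = M $$ (i, j)"
      using colK[of j i] rowK[of i j] ij v Cons.prems(5)[of i v] Cons.prems(5)[of v j] by auto
    then show ?thesis using True by (auto simp: mut_step_def)
  next
    case False
    show ?thesis
    proof (cases "i = v \<or> j = v")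
      case True
      \<comment> \<open>Every later correction in row or column \<open>v\<close> has a factor from
        the vanishing block.\<close>
      have "(\<Sum>k\<in>set vs. (\<bar>?M $$ (i, k)\<bar> * ?M $$ (k, j) + ?M $$ (i, k) * \<bar>?M $$ (k, j)\<bar>) / 2) = 0"
      proof (rule sum.neutral, rule ballI)
        fix k assume k: "k \<in> set vs"
        have "?M $$ (i, k) = 0 \<or> ?M $$ (k, j) = 0"
          using True colK[OF k ij(1)] rowK[OF k ij(2)] Cons.prems(5)[of v k] Cons.prems(5)[of k v] k by auto
        then show "(\<bar>?M $$ (i, k)\<bar> * ?M $$ (k, j) + ?M $$ (i, k) * \<bar>?M $$ (k, j)\<bar>) / 2 = 0" by auto
      qed
      moreover have "?M $$ (i, j) = - M $$ (i, j)" using idx[OF ij] True by auto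
      ultimately show ?thesis using True False by (auto simp: mut_step_def)
    next
      case nv: False
      have "(\<Sum>k\<in>set vs. (\<bar>?M $$ (i, k)\<bar> * ?M $$ (k, j) + ?M $$ (i, k) * \<bar>?M $$ (k, j)\<bar>) / 2)
          = (\<Sum>k\<in>set vs. (\<bar>M $$ (i, k)\<bar> * M $$ (k, j) + M $$ (i, k) * \<bar>M $$ (k, j)\<bar>) / 2)"
        using nv colK[OF _ ij(1)] rowK[OF _ ij(2)] by (intro sum.cong) auto
      then show ?thesis
        using nv False v(2) idx[OF ij] by (simp add: mut_step_def)
    qed
  qed
  then show ?case using IH by simp
qed

lemma represents_fold_mutate:
  assumes "represents N M t l" "distinct vs" "set vs \<subseteq> {..<N}"
    and "\<And>v w. v \<in> set vs \<Longrightarrow> w \<in> set vs \<Longrightarrow> t v w = 0"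
  shows "represents N (fold mutate vs M) (mut_step (set vs) (set vs) t t) (mut_step {} (set vs) t l)"
proof -
  have M: "dim_row M = 2 * N" "dim_col M = N"
    and tl: "\<And>i j. i < N \<Longrightarrow> j < N \<Longrightarrow> M $$ (i, j) = t i j"
      "\<And>i j. i < N \<Longrightarrow> j < N \<Longrightarrow> M $$ (N + i, j) = l i j"
    using assms(1) by (auto simp: represents_def)
  have lt: "w < N" if "w \<in> set vs" for w
    using that assms(3) by auto
  then have nin: "N + i \<notin> set vs" for i
    by (metis not_add_less1)
  have "M $$ (v, w) = 0" if "v \<in> set vs" "w \<in> set vs" for v w
    using that assms(3,4) tl(1)[of v w] by auto
  note * = fold_mutate_commuting[OF M assms(2,3) this]
  have top: "(\<Sum>k\<in>set vs. (\<bar>M $$ (i, k)\<bar> * M $$ (k, j) + M $$ (i, k) * \<bar>M $$ (k, j)\<bar>) / 2) =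
        (\<Sum>k\<in>set vs. (\<bar>t i k\<bar> * t k j + t i k * \<bar>t k j\<bar>) / 2)" if "i < N" "j < N" for i j
    using that lt by (intro sum.cong) (simp_all add: tl)
  have bot: "(\<Sum>k\<in>set vs. (\<bar>M $$ (N + i, k)\<bar> * M $$ (k, j) + M $$ (N + i, k) * \<bar>M $$ (k, j)\<bar>) / 2) =
        (\<Sum>k\<in>set vs. (\<bar>l i k\<bar> * t k j + l i k * \<bar>t k j\<bar>) / 2)" if "i < N" "j < N" for i j
    using that lt by (intro sum.cong) (simp_all add: tl)
  show ?thesis
    using * by (simp add: represents_def mut_step_def tl top bot nin)
qed

section \<open>Weighted foldings: relations and signs under mutation\<close>

locale fold_pair =
  fixes N N' :: nat and F :: "nat \<Rightarrow> nat" and kappa :: "nat \<Rightarrow> real" and rep :: "nat \<Rightarrow> nat"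
  assumes F_less: "i < N \<Longrightarrow> F i < N'"
    and kappa_pos: "i < N \<Longrightarrow> kappa i > 0"
    and rep: "b < N' \<Longrightarrow> rep b < N \<and> F (rep b) = b \<and> kappa (rep b) = 1"
begin

definition fib :: "nat \<Rightarrow> nat set" where
  "fib a = {i. i < N \<and> F i = a}"

definition related :: "(nat \<Rightarrow> nat \<Rightarrow> real) \<Rightarrow> (nat \<Rightarrow> nat \<Rightarrow> real) \<Rightarrow> bool" where
  "related l l' \<longleftrightarrow>
     (\<forall>a<N'. \<forall>j<N. (\<Sum>i\<in>fib a. kappa i * l i j) = kappa j * l' a (F j)) \<and>
     (\<forall>i<N. \<forall>b<N'. (\<Sum>j\<in>fib b. kappa j * l i j) = kappa i * l' (F i) b)"

text \<open>The multiplicative form gives one scalar per block in place of the absolute values.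
  Where the entry of \<open>l'\<close> is zero, \<open>sgn 0 = 0\<close> forces the whole block to
  vanish.\<close>

definition coherent :: "(nat \<Rightarrow> nat \<Rightarrow> real) \<Rightarrow> (nat \<Rightarrow> nat \<Rightarrow> real) \<Rightarrow> bool" where
  "coherent l l' \<longleftrightarrow> (\<forall>i<N. \<forall>j<N. \<bar>l i j\<bar> = sgn (l' (F i) (F j)) * l i j)"

definition column_coherent :: "(nat \<Rightarrow> nat \<Rightarrow> real) \<Rightarrow> bool" where
  "column_coherent l' \<longleftrightarrow> (\<forall>b<N'. \<exists>e. e \<noteq> 0 \<and> (\<forall>a<N'. \<bar>l' a b\<bar> = e * l' a b))"

lemma finite_fib [simp]: "finite (fib a)"
  by (simp add: fib_def)

lemma mem_fib [simp]: "i \<in> fib a \<longleftrightarrow> i < N \<and> F i = a"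
  by (simp add: fib_def)

lemma abs_sgn_mult: "\<bar>x\<bar> = sgn x * (x :: real)"
  by (simp add: abs_sgn mult.commute)

text \<open>Once the signs are fixed, the coefficient depends only on the fibres of \<open>i\<close>
  and \<open>j\<close>, and it is the one that occurs downstairs in
  \<open>mut_step_singleton\<close>.\<close>

lemma mut_step_coherent:
  assumes "coherent t t'" "coherent l l'" "i < N" "j < N" "i \<notin> R" "F j \<noteq> k"
  shows "mut_step R (fib k) t l i j =
    l i j + (sgn (l' (F i) k) + sgn (t' k (F j))) / 2 * (\<Sum>p\<in>fib k. l i p * t p j)"
proof -
  have "(\<Sum>p\<in>fib k. (\<bar>l i p\<bar> * t p j + l i p * \<bar>t p j\<bar>) / 2) =
        (\<Sum>p\<in>fib k. (sgn (l' (F i) k) + sgn (t' k (F j))) / 2 * (l i p * t p j))"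
  proof (rule sum.cong[OF refl])
    fix p assume "p \<in> fib k"
    then have *: "\<bar>l i p\<bar> = sgn (l' (F i) k) * l i p" "\<bar>t p j\<bar> = sgn (t' k (F j)) * t p j"
      using assms by (auto simp: coherent_def)
    show "(\<bar>l i p\<bar> * t p j + l i p * \<bar>t p j\<bar>) / 2 =
        (sgn (l' (F i) k) + sgn (t' k (F j))) / 2 * (l i p * t p j)"
      unfolding * by (simp add: field_simps)
  qed
  then show ?thesis using assms by (simp add: mut_step_def sum_distrib_left)
qed

lemma mut_step_singleton:
  assumes "i \<notin> R" "j \<noteq> k"
  shows "mut_step R {k} t' l' i j = l' i j + (sgn (l' i k) + sgn (t' k j)) / 2 * (l' i k * t' k j)"
  using assms unfolding mut_step_def
  by (simp add: abs_sgn_mult[of "l' i k"] abs_sgn_mult[of "t' k j"] field_simps)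

text \<open>Summing over the row fibre turns \<open>l i p\<close> into
  \<open>kappa p * l' a k\<close>. The weight \<open>kappa p\<close> released in this way makes the
  sum over \<open>p\<close> an instance of the row relation for \<open>t\<close>, which leaves
  \<open>kappa j * t' k (F j)\<close>. The column relation is obtained symmetrically, with
  \<open>t\<close> summed first.\<close>

lemma related_mut_step:
  assumes t: "related t t'" "coherent t t'" and l: "related l l'" "coherent l l'"
    and k: "k < N'" and R: "\<And>i. i < N \<Longrightarrow> i \<in> R \<longleftrightarrow> F i \<in> R'"
  shows "related (mut_step R (fib k) t l) (mut_step R' {k} t' l')"
  unfolding related_def
proof (intro conjI allI impI)
  fix a j assume a: "a < N'" and j: "j < N"
  have lj: "(\<Sum>i\<in>fib a. kappa i * l i j) = kappa j * l' a (F j)" if "j < N" for j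
    using l(1) a that by (simp add: related_def)
  have tj: "(\<Sum>p\<in>fib k. kappa p * t p j) = kappa j * t' k (F j)"
    using t(1) k j by (simp add: related_def)
  show "(\<Sum>i\<in>fib a. kappa i * mut_step R (fib k) t l i j) = kappa j * mut_step R' {k} t' l' a (F j)"
  proof (cases "a \<in> R' \<or> F j = k")
    case True
    have "(\<Sum>i\<in>fib a. kappa i * mut_step R (fib k) t l i j) = (\<Sum>i\<in>fib a. - (kappa i * l i j))"
      using True R j by (intro sum.cong) (auto simp: mut_step_def)
    also have "\<dots> = kappa j * mut_step R' {k} t' l' a (F j)"
      using True lj[OF j] by (simp add: sum_negf mut_step_def)
    finally show ?thesis .
  next
    case False
    let ?c = "(sgn (l' a k) + sgn (t' k (F j))) / 2"
    have step: "mut_step R (fib k) t l i j = l i j + ?c * (\<Sum>p\<in>fib k. l i p * t p j)" if "i \<in> fib a" for i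
      using that False R j mut_step_coherent[OF t(2) l(2), of i j R k] by auto
    have "(\<Sum>i\<in>fib a. kappa i * mut_step R (fib k) t l i j) =
        (\<Sum>i\<in>fib a. kappa i * l i j + ?c * (\<Sum>p\<in>fib k. (kappa i * l i p) * t p j))"
      by (intro sum.cong refl) (simp only: step distrib_left sum_distrib_left sum_distrib_right mult_ac)
    also have "\<dots> = kappa j * l' a (F j) + ?c * (\<Sum>i\<in>fib a. \<Sum>p\<in>fib k. (kappa i * l i p) * t p j)"
      by (simp only: sum.distrib lj[OF j] sum_distrib_left[symmetric])
    also have "(\<Sum>i\<in>fib a. \<Sum>p\<in>fib k. (kappa i * l i p) * t p j) =
        (\<Sum>p\<in>fib k. (\<Sum>i\<in>fib a. kappa i * l i p) * t p j)"
      by (subst sum.swap) (simp add: sum_distrib_right)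
    also have "\<dots> = (\<Sum>p\<in>fib k. l' a k * (kappa p * t p j))"
      by (intro sum.cong) (auto simp: lj)
    also have "\<dots> = l' a k * (kappa j * t' k (F j))"
      by (simp only: sum_distrib_left[symmetric] tj)
    finally show ?thesis
      using False by (simp add: mut_step_singleton algebra_simps)
  qed
next
  fix i b assume i: "i < N" and b: "b < N'"
  have li: "(\<Sum>j\<in>fib b. kappa j * l i j) = kappa i * l' (F i) b" if "b < N'" for b
    using l(1) i that by (simp add: related_def)
  have tp: "(\<Sum>j\<in>fib b. kappa j * t p j) = kappa p * t' (F p) b" if "p < N" for p
    using t(1) b that by (simp add: related_def)
  show "(\<Sum>j\<in>fib b. kappa j * mut_step R (fib k) t l i j) = kappa i * mut_step R' {k} t' l' (F i) b"
  proof (cases "F i \<in> R' \<or> b = k")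
    case True
    have "(\<Sum>j\<in>fib b. kappa j * mut_step R (fib k) t l i j) = (\<Sum>j\<in>fib b. - (kappa j * l i j))"
      using True R i by (intro sum.cong) (auto simp: mut_step_def)
    also have "\<dots> = kappa i * mut_step R' {k} t' l' (F i) b"
      using True li[OF b] by (simp add: sum_negf mut_step_def)
    finally show ?thesis .
  next
    case False
    let ?c = "(sgn (l' (F i) k) + sgn (t' k b)) / 2"
    have step: "mut_step R (fib k) t l i j = l i j + ?c * (\<Sum>p\<in>fib k. l i p * t p j)" if "j \<in> fib b" for j
      using that False R i mut_step_coherent[OF t(2) l(2), of i j R k] by auto
    have "(\<Sum>j\<in>fib b. kappa j * mut_step R (fib k) t l i j) =
        (\<Sum>j\<in>fib b. kappa j * l i j + ?c * (\<Sum>p\<in>fib k. l i p * (kappa j * t p j)))"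
      by (intro sum.cong refl) (simp only: step distrib_left sum_distrib_left sum_distrib_right mult_ac)
    also have "\<dots> = kappa i * l' (F i) b + ?c * (\<Sum>j\<in>fib b. \<Sum>p\<in>fib k. l i p * (kappa j * t p j))"
      by (simp only: sum.distrib li[OF b] sum_distrib_left[symmetric])
    also have "(\<Sum>j\<in>fib b. \<Sum>p\<in>fib k. l i p * (kappa j * t p j)) =
        (\<Sum>p\<in>fib k. l i p * (\<Sum>j\<in>fib b. kappa j * t p j))"
      by (subst sum.swap) (simp add: sum_distrib_left)
    also have "\<dots> = (\<Sum>p\<in>fib k. (kappa p * l i p) * t' k b)"
      by (intro sum.cong) (auto simp: tp)
    also have "\<dots> = kappa i * l' (F i) k * t' k b"
      by (simp only: sum_distrib_right[symmetric] li[OF k])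
    finally show ?thesis
      using False by (simp add: mut_step_singleton algebra_simps)
  qed
qed

text \<open>With one sign per block the weighted sum cannot cancel: a nonzero entry times its
  positive weight bounds the sum from below, so the entry of \<open>l'\<close> has the same strict
  sign.\<close>

lemma coherentI:
  assumes "related l l'"
    and "\<And>a b. a < N' \<Longrightarrow> b < N' \<Longrightarrow>
      \<exists>e\<in>{1, -1}. \<forall>i\<in>fib a. \<forall>j\<in>fib b. e * l i j \<ge> 0"
  shows "coherent l l'"
  unfolding coherent_def
proof (intro allI impI)
  fix i j assume i: "i < N" and j: "j < N"
  obtain e where "e \<in> {1, -1::real}"
    and pos: "\<forall>p\<in>fib (F i). \<forall>q\<in>fib (F j). e * l p q \<ge> 0"
    using assms(2)[of "F i" "F j"] F_less i j by blast
  then have e: "e = 1 \<or> e = -1" by simp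
  have "e * (kappa i * l i j) \<le> (\<Sum>p\<in>fib (F i). e * (kappa p * l p j))"
  proof (rule member_le_sum)
    show "0 \<le> e * (kappa p * l p j)" if "p \<in> fib (F i) - {i}" for p
      using that pos j kappa_pos[of p] mult_nonneg_nonneg[of "kappa p" "e * l p j"]
      by (simp add: mult.left_commute)
  qed (use i in auto)
  also have "\<dots> = e * (kappa j * l' (F i) (F j))"
    using assms(1) i j F_less by (simp add: related_def sum_distrib_left[symmetric])
  finally have le: "kappa i * (e * l i j) \<le> kappa j * (e * l' (F i) (F j))"
    by (simp add: algebra_simps)
  have nonneg: "e * l i j \<ge> 0" using pos i j by auto
  show "\<bar>l i j\<bar> = sgn (l' (F i) (F j)) * l i j"
  proof (cases "l i j = 0")
    case False
    then have "e * l i j > 0" using nonneg e by auto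
    then have "kappa i * (e * l i j) > 0"
      using kappa_pos[OF i] by simp
    then have "e * l' (F i) (F j) > 0"
      using le kappa_pos[OF j] by (metis less_le_trans zero_less_mult_pos)
    then show ?thesis using e nonneg by (auto simp: sgn_if)
  qed simp
qed

lemma column_coherentI:
  assumes "related l l'"
    and "\<And>b. b < N' \<Longrightarrow> \<exists>e\<in>{1, -1}. \<forall>i<N. \<forall>j\<in>fib b. e * l i j \<ge> 0"
  shows "column_coherent l'"
  unfolding column_coherent_def
proof (intro allI impI)
  fix b assume b: "b < N'"
  obtain e where "e \<in> {1, -1::real}"
    and pos: "\<forall>p<N. \<forall>q\<in>fib b. e * l p q \<ge> 0"
    using assms(2)[of b] b by blast
  then have e: "e = 1 \<or> e = -1" by simp
  have "\<bar>l' a b\<bar> = e * l' a b" if a: "a < N'" for a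
  proof -
    have "e * l' a b = (\<Sum>i\<in>fib a. kappa i * (e * l i (rep b)))"
      using assms(1) a rep[OF b] unfolding related_def
      by (simp add: sum_distrib_left[symmetric] mult.left_commute)
    also have "\<dots> \<ge> 0"
    proof (rule sum_nonneg)
      show "0 \<le> kappa i * (e * l i (rep b))" if "i \<in> fib a" for i
        using that pos rep[OF b] kappa_pos[of i] mult_nonneg_nonneg[of "kappa i" "e * l i (rep b)"] by simp
    qed
    finally show ?thesis using e by auto
  qed
  then show "\<exists>e. e \<noteq> 0 \<and> (\<forall>a<N'. \<bar>l' a b\<bar> = e * l' a b)"
    using e by (intro exI[of _ e]) auto
qed

end

text \<open>On columns of one common sign, mutation is right multiplication by
  \<open>E = d + x\<close>, with \<open>d\<close> diagonal and \<open>x\<close> supported in rows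
  \<open>K\<close> and columns outside \<open>K\<close>. As matrices, \<open>d * x = - x\<close>,
  \<open>x * d = x\<close> and \<open>x * x = 0\<close>, so \<open>E\<close> is an
  involution.\<close>

lemma det_mut_step_nonzero:
  assumes "K \<subseteq> {..<N}" "e \<noteq> 0"
    and e: "\<And>i k. i < N \<Longrightarrow> k \<in> K \<Longrightarrow> \<bar>l i k\<bar> = e * l i k"
    and "det (mat N N (\<lambda>(i, j). l i j)) \<noteq> 0"
  shows "det (mat N N (\<lambda>(i, j). mut_step {} K t l i j)) \<noteq> 0"
proof -
  \<comment> \<open>The mutation summand at \<open>p\<close> factors as \<open>l i p * y p j\<close>
    once \<open>e\<close> absorbs the absolute value of \<open>l i p\<close>.\<close>
  define y where "y p j = (e * t p j + \<bar>t p j\<bar>) / 2" for p j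
  define x where "x p j = (if j \<notin> K \<and> p \<in> K then y p j else 0)" for p j
  define d :: "nat \<Rightarrow> nat \<Rightarrow> real" where "d p j = (if p = j then if j \<in> K then -1 else 1 else 0)" for p j
  define E where "E = mat N N (\<lambda>(p, j). d p j + x p j)"
  let ?C = "mat N N (\<lambda>(i, j). l i j)"
  have E: "E \<in> carrier_mat N N" and C: "?C \<in> carrier_mat N N" by (simp_all add: E_def)
  have finK: "finite K" using assms(1) finite_subset by blast
  have sumK: "(\<Sum>p\<in>{0..<N}. f p * x p j) = (if j \<in> K then 0 else \<Sum>p\<in>K. f p * y p j)" for f j
  proof -
    have "(\<Sum>p\<in>{0..<N}. f p * x p j) = (\<Sum>p\<in>K. f p * x p j)"
      using assms(1) by (intro sum.mono_neutral_right) (auto simp: x_def)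
    then show ?thesis by (auto simp: x_def intro!: sum.cong sum.neutral)
  qed
  have sumd: "(\<Sum>p\<in>{0..<N}. f p * d p j) = (if j \<in> K then - f j else f j)" if "j < N" for f j
  proof -
    have "(\<Sum>p\<in>{0..<N}. f p * d p j) = (\<Sum>p\<in>{0..<N}. if p = j then (if j \<in> K then - f j else f j) else 0)"
      by (intro sum.cong) (auto simp: d_def)
    then show ?thesis using that by simp
  qed
  have "E * E = 1\<^sub>m N"
  proof (rule eq_matI)
    fix i j assume ij: "i < dim_row (1\<^sub>m N)" "j < dim_col (1\<^sub>m N :: real mat)"
    have "(E * E) $$ (i, j) = (\<Sum>p\<in>{0..<N}. (d i p + x i p) * (d p j + x p j))"
      using ij by (simp add: E_def scalar_prod_def)
    also have "\<dots> = (\<Sum>p\<in>{0..<N}. (d i p + x i p) * d p j) + (\<Sum>p\<in>{0..<N}. (d i p + x i p) * x p j)"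
      by (simp add: distrib_left sum.distrib)
    also have "\<dots> = (if j \<in> K then - (d i j + x i j) else d i j + x i j) +
        (if j \<in> K then 0 else \<Sum>p\<in>K. (d i p + x i p) * y p j)"
      using ij by (simp add: sumd sumK)
    also have "(\<Sum>p\<in>K. (d i p + x i p) * y p j) =
        (\<Sum>p\<in>K. if p = i then - y p j else 0)"
      by (intro sum.cong) (auto simp: d_def x_def)
    also have "\<dots> = (if i \<in> K then - y i j else 0)"
      using finK by simp
    also have "(if j \<in> K then - (d i j + x i j) else d i j + x i j) +
        (if j \<in> K then 0 else if i \<in> K then - y i j else 0) = 1\<^sub>m N $$ (i, j)"
      using ij by (auto simp: d_def x_def)
    finally show "(E * E) $$ (i, j) = 1\<^sub>m N $$ (i, j)" .
  qed (simp_all add: E_def)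
  then have "det E * det E = 1"
    using det_mult[OF E E] by simp
  then have "det E \<noteq> 0" by auto
  moreover have "mat N N (\<lambda>(i, j). mut_step {} K t l i j) = ?C * E"
  proof (rule eq_matI)
    fix i j assume "i < dim_row (?C * E)" "j < dim_col (?C * E)"
    then have ij: "i < N" "j < N" by (simp_all add: E_def)
    have "(?C * E) $$ (i, j) = (\<Sum>p\<in>{0..<N}. l i p * (d p j + x p j))"
      using ij by (simp add: E_def scalar_prod_def)
    also have "\<dots> = (\<Sum>p\<in>{0..<N}. l i p * d p j) + (\<Sum>p\<in>{0..<N}. l i p * x p j)"
      by (simp add: distrib_left sum.distrib)
    also have "\<dots> = mut_step {} K t l i j"
    proof (cases "j \<in> K")
      case False
      have "(\<Sum>p\<in>K. l i p * y p j) = (\<Sum>k\<in>K. (\<bar>l i k\<bar> * t k j + l i k * \<bar>t k j\<bar>) / 2)"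
        using ij by (intro sum.cong) (simp_all add: e y_def field_simps)
      then show ?thesis using False ij by (simp add: sumd sumK mut_step_def)
    qed (use ij in \<open>simp add: sumd sumK mut_step_def\<close>)
    finally show "mat N N (\<lambda>(i, j). mut_step {} K t l i j) $$ (i, j) = (?C * E) $$ (i, j)"
      using ij by simp
  qed (simp_all add: E_def)
  ultimately show ?thesis
    using det_mult[OF C E] assms(4) by simp
qed

context fold_pair begin

lemma related_inverse_transpose:
  assumes rel: "related l l'"
    and G: "G \<in> carrier_mat N N" "transpose_mat (mat N N (\<lambda>(i, j). l i j)) * G = 1\<^sub>m N"
    and G': "G' \<in> carrier_mat N' N'" "G' * transpose_mat (mat N' N' (\<lambda>(i, j). l' i j)) = 1\<^sub>m N'"
    and a: "a < N'" and j: "j < N"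
  shows "(\<Sum>i\<in>fib a. kappa i * G $$ (i, j)) = kappa j * G' $$ (a, F j)"
proof -
  define D where "D = mat N' N (\<lambda>(a, i). if F i = a then kappa i else 0)"
  let ?C = "transpose_mat (mat N N (\<lambda>(i, j). l i j))"
  let ?C' = "transpose_mat (mat N' N' (\<lambda>(i, j). l' i j))"
  have D: "D \<in> carrier_mat N' N" and C: "?C \<in> carrier_mat N N" and C': "?C' \<in> carrier_mat N' N'"
    by (simp_all add: D_def)
  have D_sum: "(\<Sum>i\<in>{0..<N}. D $$ (b, i) * f i) = (\<Sum>i\<in>fib b. kappa i * f i)" if "b < N'" for b f
  proof -
    have "(\<Sum>i\<in>{0..<N}. D $$ (b, i) * f i) = (\<Sum>i\<in>fib b. D $$ (b, i) * f i)"
      using that by (intro sum.mono_neutral_right) (auto simp: D_def)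
    also have "\<dots> = (\<Sum>i\<in>fib b. kappa i * f i)"
      using that by (intro sum.cong) (auto simp: D_def)
    finally show ?thesis .
  qed
  have D_col: "(\<Sum>b\<in>{0..<N'}. f b * D $$ (b, i)) = f (F i) * kappa i" if "i < N" for i f
  proof -
    have "(\<Sum>b\<in>{0..<N'}. f b * D $$ (b, i)) = (\<Sum>b\<in>{0..<N'}. if b = F i then f b * kappa i else 0)"
      using that by (intro sum.cong) (auto simp: D_def)
    then show ?thesis using F_less[OF that] by simp
  qed
  have "D * ?C = ?C' * D"
  proof (rule eq_matI)
    fix b i assume "b < dim_row (?C' * D)" "i < dim_col (?C' * D)"
    then have bi: "b < N'" "i < N" by (simp_all add: D_def)
    have "(D * ?C) $$ (b, i) = (\<Sum>p\<in>{0..<N}. D $$ (b, p) * l i p)"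
      using bi D by (simp add: scalar_prod_def)
    also have "\<dots> = kappa i * l' (F i) b"
      using rel bi by (simp add: D_sum related_def)
    also have "\<dots> = (\<Sum>p\<in>{0..<N'}. l' p b * D $$ (p, i))"
      using bi by (simp add: D_col)
    also have "\<dots> = (?C' * D) $$ (b, i)"
      using bi D by (simp add: scalar_prod_def)
    finally show "(D * ?C) $$ (b, i) = (?C' * D) $$ (b, i)" .
  qed (simp_all add: D_def)
  then have "G' * ((D * ?C) * G) = G' * ((?C' * D) * G)"
    by simp
  moreover have "(D * ?C) * G = D"
    using D C G by (simp add: assoc_mult_mat[OF D C G(1)])
  moreover have "G' * ((?C' * D) * G) = D * G"
  proof -
    have "G' * ((?C' * D) * G) = (G' * (?C' * D)) * G"
      using assoc_mult_mat[OF G'(1) mult_carrier_mat[OF C' D] G(1)] by simp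
    also have "G' * (?C' * D) = (G' * ?C') * D"
      using assoc_mult_mat[OF G'(1) C' D] by simp
    finally show ?thesis using D G'(2) by simp
  qed
  ultimately have DG: "D * G = G' * D" by simp
  have "(\<Sum>i\<in>fib a. kappa i * G $$ (i, j)) = (D * G) $$ (a, j)"
    using a j D G(1) D_sum[OF a, of "\<lambda>i. G $$ (i, j)"] by (simp add: scalar_prod_def)
  also have "\<dots> = (G' * D) $$ (a, j)" by (simp add: DG)
  also have "\<dots> = kappa j * G' $$ (a, F j)"
    using a j D G'(1) D_col[OF j, of "\<lambda>b. G' $$ (a, b)"] by (simp add: scalar_prod_def)
  finally show ?thesis .
qed

definition nonsing :: "nat \<Rightarrow> (nat \<Rightarrow> nat \<Rightarrow> real) \<Rightarrow> bool" where
  "nonsing n l \<longleftrightarrow> det (mat n n (\<lambda>(i, j). l i j)) \<noteq> 0"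

text \<open>\<open>P\<close> is the knowledge about a state that is specific to the type: the
  explicit matrices upstairs for the path, the seed downstairs and integrality upstairs for H3 and
  H4. Signs on the other side follow from the relations, which is why these are premises of
  \<open>coh\<close>.\<close>

lemma fold_invariant:
  fixes P :: "(nat \<Rightarrow> nat \<Rightarrow> real) \<Rightarrow> (nat \<Rightarrow> nat \<Rightarrow> real) \<Rightarrow>
      (nat \<Rightarrow> nat \<Rightarrow> real) \<Rightarrow> (nat \<Rightarrow> nat \<Rightarrow> real) \<Rightarrow> bool"
  assumes coh: "\<And>t l t' l'. P t l t' l' \<Longrightarrow> related t t' \<Longrightarrow> related l l' \<Longrightarrow>
      coherent t t' \<and> coherent l l' \<and> column_coherent l' \<and> (\<forall>k<N'. t' k k = 0)"
    and step: "\<And>t l t' l' k. P t l t' l' \<Longrightarrow> related t t' \<Longrightarrow> related l l' \<Longrightarrow> k < N' \<Longrightarrow>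
      P (mut_step (fib k) (fib k) t t) (mut_step {} (fib k) t l)
        (mut_step {k} {k} t' t') (mut_step {} {k} t' l')"
    and "P t l t' l'" "related t t'" "related l l'" "nonsing N l" "nonsing N' l'"
    and "represents N M t l" "represents N' M' t' l'"
    and "\<forall>k\<in>set ks. k < N'"
  shows "\<exists>t l t' l'. related l l' \<and> nonsing N l \<and> nonsing N' l' \<and>
    represents N (fold (comp_mutate N F) ks M) t l \<and> represents N' (fold mutate ks M') t' l'"
  using assms(3-)
proof (induction ks arbitrary: M M' t l t' l')
  case Nil
  then show ?case by auto
next
  case (Cons k ks)
  have k: "k < N'" using Cons.prems by simp
  note P = Cons.prems(1-3)
  have c: "coherent t t'" "coherent l l'" "column_coherent l'" "\<And>k. k < N' \<Longrightarrow> t' k k = 0"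
    using coh[OF P] by auto
  \<comment> \<open>A zero diagonal entry downstairs kills the diagonal block upstairs, so the
    mutations of one fibre commute.\<close>
  have fib_zero: "t v w = 0" if "v \<in> fib k" "w \<in> fib k" for v w
    using c(1) c(4)[OF k] that unfolding coherent_def by fastforce
  obtain e where e: "e \<noteq> 0" "\<And>a. a < N' \<Longrightarrow> \<bar>l' a k\<bar> = e * l' a k"
    using c(3) k by (auto simp: column_coherent_def)
  \<comment> \<open>All columns of the fibre inherit the sign of column \<open>k\<close> downstairs,
    so one \<open>e\<close> serves the whole composite mutation.\<close>
  have e_l: "\<bar>l i p\<bar> = e * l i p" if "i < N" "p \<in> fib k" for i p
  proof -
    have abs_l: "\<bar>l i p\<bar> = sgn (l' (F i) k) * l i p"
      using c(2) that by (auto simp: coherent_def)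
    show ?thesis
    proof (cases "l' (F i) k = 0")
      case True
      then have "l i p = 0" using abs_l by simp
      then show ?thesis by simp
    next
      case False
      have "\<bar>l' (F i) k\<bar> = e * l' (F i) k" using e(2) F_less[OF that(1)] by simp
      then have "sgn (l' (F i) k) = e" using False by (simp add: abs_sgn_mult)
      then show ?thesis using abs_l by simp
    qed
  qed
  have "set (filter (\<lambda>v. F v = k) [0..<N]) = fib k" by auto
  then have M1: "represents N (comp_mutate N F k M) (mut_step (fib k) (fib k) t t) (mut_step {} (fib k) t l)"
    using represents_fold_mutate[OF Cons.prems(6), of "filter (\<lambda>v. F v = k) [0..<N]"] fib_zero
    by (auto simp: comp_mutate_def)
  have M1': "represents N' (mutate k M') (mut_step {k} {k} t' t') (mut_step {} {k} t' l')"
    using represents_fold_mutate[OF Cons.prems(7), of "[k]"] k c(4) by auto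
  have "nonsing N (mut_step {} (fib k) t l)"
    unfolding nonsing_def
    by (rule det_mut_step_nonzero[where e = e]) (use e(1) e_l Cons.prems(4) in \<open>auto simp: nonsing_def\<close>)
  moreover have "nonsing N' (mut_step {} {k} t' l')"
    unfolding nonsing_def
    by (rule det_mut_step_nonzero[where e = e]) (use e k Cons.prems(5) in \<open>auto simp: nonsing_def\<close>)
  moreover have "related (mut_step (fib k) (fib k) t t) (mut_step {k} {k} t' t')"
    using P c k by (intro related_mut_step) auto
  moreover have "related (mut_step {} (fib k) t l) (mut_step {} {k} t' l')"
    using P c k by (intro related_mut_step) auto
  ultimately show ?case
    using Cons.IH[OF step[OF P k] _ _ _ _ M1 M1'] Cons.prems(8) by simp
qed

end

lemma mat_inverse_transpose_exists:
  fixes C :: "real mat"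
  assumes "C \<in> carrier_mat n n" "det C \<noteq> 0"
  shows "\<exists>G. mat_inverse (transpose_mat C) = Some G \<and> G \<in> carrier_mat n n \<and>
    transpose_mat C * G = 1\<^sub>m n \<and> G * transpose_mat C = 1\<^sub>m n"
proof -
  have T: "transpose_mat C \<in> carrier_mat n n" using assms(1) by simp
  have "det (transpose_mat C) \<noteq> 0" using det_transpose[OF assms(1)] assms(2) by simp
  then have "transpose_mat C \<in> Units (ring_mat TYPE(real) n undefined)"
    by (rule det_non_zero_imp_unit[OF T])
  then obtain G where G: "mat_inverse (transpose_mat C) = Some G"
    using mat_inverse(1)[OF T, of undefined] by (cases "mat_inverse (transpose_mat C)") auto
  then show ?thesis using mat_inverse(2)[OF T G] by auto
qed

context fold_pair begin

theorem dF_C_G: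
  assumes fd: "fN fd = N" "fN' fd = N'" "fF fd = F" "fkappa fd = kappa"
    and rep_fd: "\<And>b. b < N' \<Longrightarrow> rep_vertex fd b = rep b"
    and rel: "related (fS fd) (fB' fd)"
    and coh: "\<And>t l t' l'. P t l t' l' \<Longrightarrow> related t t' \<Longrightarrow> related l l' \<Longrightarrow>
      coherent t t' \<and> coherent l l' \<and> column_coherent l' \<and> (\<forall>k<N'. t' k k = 0)"
    and step: "\<And>t l t' l' k. P t l t' l' \<Longrightarrow> related t t' \<Longrightarrow> related l l' \<Longrightarrow> k < N' \<Longrightarrow>
      P (mut_step (fib k) (fib k) t t) (mut_step {} (fib k) t l)
        (mut_step {k} {k} t' t') (mut_step {} {k} t' l')"
    and init: "P (fS fd) (\<lambda>i j. if i = j then 1 else 0) (fB' fd) (\<lambda>i j. if i = j then 1 else 0)"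
    and ks: "\<forall>k\<in>set ks. k < N'"
  shows "dF_mat fd (C_Delta fd ks) = C_Delta' fd ks
       \<and> (\<exists>G G'. mat_inverse (transpose_mat (C_Delta fd ks)) = Some G
              \<and> mat_inverse (transpose_mat (C_Delta' fd ks)) = Some G'
              \<and> dF_mat fd G = G')"
proof -
  let ?I = "\<lambda>i j. if i = j then 1 else 0 :: real"
  have repI: "represents n (ext_init n B) B ?I" for n B
    by (auto simp: represents_def ext_init_def)
  have nsI: "nonsing n ?I" for n
  proof -
    have "mat n n (\<lambda>(i, j). ?I i j) = 1\<^sub>m n" by (rule eq_matI) auto
    then show ?thesis by (simp add: nonsing_def)
  qed
  have sumI: "(\<Sum>i\<in>fib a. kappa i * ?I i j) = (if F j = a then kappa j else 0)" if "j < N" for a j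
  proof -
    have "(\<Sum>i\<in>fib a. kappa i * ?I i j) = (\<Sum>i\<in>fib a. if i = j then kappa j else 0)"
      by (intro sum.cong) auto
    then show ?thesis using that by simp
  qed
  have sumI': "(\<Sum>j\<in>fib b. kappa j * ?I i j) = (if F i = b then kappa i else 0)" if "i < N" for b i
  proof -
    have "(\<Sum>j\<in>fib b. kappa j * ?I i j) = (\<Sum>j\<in>fib b. if j = i then kappa i else 0)"
      by (intro sum.cong) auto
    then show ?thesis using that by simp
  qed
  have relI: "related ?I ?I"
    unfolding related_def using sumI sumI' by simp
  have "\<exists>t l t' l'. related l l' \<and> nonsing N l \<and> nonsing N' l' \<and>
    represents N (fold (comp_mutate N F) ks (ext_init N (fS fd))) t l \<and>
    represents N' (fold mutate ks (ext_init N' (fB' fd))) t' l'"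
    by (rule fold_invariant[of P, OF coh step init rel relI nsI nsI repI repI ks])
  then obtain t l t' l' where r: "related l l'" and ns: "nonsing N l" "nonsing N' l'"
    and reps: "represents N (fold (comp_mutate N F) ks (ext_init N (fS fd))) t l"
      "represents N' (fold mutate ks (ext_init N' (fB' fd))) t' l'"
    by blast
  have C: "C_Delta fd ks = mat N N (\<lambda>(i, j). l i j)"
    using reps(1) by (auto simp: C_Delta_def fd lower_half_def represents_def)
  have C': "C_Delta' fd ks = mat N' N' (\<lambda>(i, j). l' i j)"
    using reps(2) by (auto simp: C_Delta'_def fd lower_half_def represents_def)
  \<comment> \<open>At the column \<open>rep b\<close>, whose weight is 1, the row relation becomes
    the defining formula of \<open>dF_mat\<close>.\<close>
  have dF: "dF_mat fd X = X'" if X': "X' \<in> carrier_mat N' N'"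
    and eq: "\<And>a j. a < N' \<Longrightarrow> j < N \<Longrightarrow> (\<Sum>i\<in>fib a. kappa i * X $$ (i, j)) = kappa j * X' $$ (a, F j)"
    for X X'
  proof (rule eq_matI)
    fix a b assume "a < dim_row X'" "b < dim_col X'"
    then have ab: "a < N'" "b < N'" using X' by auto
    have "dF_mat fd X $$ (a, b) = (\<Sum>i\<in>fib a. kappa i * X $$ (i, rep b))"
      using ab by (simp add: dF_mat_def dF_vec_def fd rep_fd fib_def)
    then show "dF_mat fd X $$ (a, b) = X' $$ (a, b)"
      using eq[OF ab(1), of "rep b"] rep[OF ab(2)] by simp
  qed (use X' in \<open>simp_all add: dF_mat_def fd\<close>)
  obtain G where G: "mat_inverse (transpose_mat (C_Delta fd ks)) = Some G" "G \<in> carrier_mat N N"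
      "transpose_mat (C_Delta fd ks) * G = 1\<^sub>m N"
    using mat_inverse_transpose_exists[of "C_Delta fd ks" N] ns(1) by (auto simp: C nonsing_def)
  obtain G' where G': "mat_inverse (transpose_mat (C_Delta' fd ks)) = Some G'" "G' \<in> carrier_mat N' N'"
      "G' * transpose_mat (C_Delta' fd ks) = 1\<^sub>m N'"
    using mat_inverse_transpose_exists[of "C_Delta' fd ks" N'] ns(2) by (auto simp: C' nonsing_def)
  have "dF_mat fd (C_Delta fd ks) = C_Delta' fd ks"
  proof (rule dF)
    fix a j assume "a < N'" "j < N"
    moreover have "(\<Sum>i\<in>fib a. kappa i * C_Delta fd ks $$ (i, j)) = (\<Sum>i\<in>fib a. kappa i * l i j)"
      using \<open>j < N\<close> by (intro sum.cong) (auto simp: C)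
    ultimately show "(\<Sum>i\<in>fib a. kappa i * C_Delta fd ks $$ (i, j)) = kappa j * C_Delta' fd ks $$ (a, F j)"
      using r F_less[of j] by (simp add: related_def C')
  qed (simp add: C')
  moreover have "dF_mat fd G = G'"
    using related_inverse_transpose[OF r G(2) _ G'(2)] G(3) G'(3)
    by (intro dF G'(2)) (auto simp: C C')
  ultimately show ?thesis using G(1) G'(1) by blast
qed

end

section \<open>Folding the path of type A\<close>

lemma chebU_sin: "chebU k (cos x) * sin x = sin (real (k + 1) * x)"
proof (induction k "cos x" rule: chebU.induct)
  case 2
  then show ?case by (simp add: sin_double)
next
  case (3 k)
  have "chebU (Suc (Suc k)) (cos x) * sin x =
      2 * cos x * (chebU (Suc k) (cos x) * sin x) - chebU k (cos x) * sin x"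
    by (simp add: algebra_simps)
  also have "\<dots> = 2 * cos x * sin (real (Suc k + 1) * x) - sin (real (k + 1) * x)"
    by (simp only: 3)
  also have "\<dots> = sin (real (Suc (Suc k) + 1) * x)"
  proof -
    have "sin (real (Suc k + 1) * x + x) + sin (real (Suc k + 1) * x - x) =
        2 * cos x * sin (real (Suc k + 1) * x)"
      by (simp only: sin_add sin_diff) (simp add: algebra_simps)
    moreover have "real (Suc k + 1) * x + x = real (Suc (Suc k) + 1) * x"
      "real (Suc k + 1) * x - x = real (k + 1) * x"
      by (simp_all add: algebra_simps)
    ultimately show ?thesis by simp
  qed
  finally show ?case .
qed simp

context
  fixes n :: nat and kap :: "nat \<Rightarrow> real"
  assumes n: "n \<ge> 2"
  defines "kap \<equiv> \<lambda>v. chebU v (cos (pi / real (2 * n + 1)))"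
begin

lemma sin_angle_pos: "0 < j \<Longrightarrow> j < 2 * n + 1 \<Longrightarrow> sin (real j * (pi / real (2 * n + 1))) > 0"
proof (rule sin_gt_zero)
  assume j: "0 < j" "j < 2 * n + 1"
  show "0 < real j * (pi / real (2 * n + 1))" using j by simp
  have "real j * pi < real (2 * n + 1) * pi" using j by simp
  then show "real j * (pi / real (2 * n + 1)) < pi" by (simp add: field_simps)
qed

lemma sin_alpha_pos: "sin (pi / real (2 * n + 1)) > 0"
  using sin_angle_pos[of 1] n by simp

lemma kap_eq: "kap v = sin (real (v + 1) * (pi / real (2 * n + 1))) / sin (pi / real (2 * n + 1))"
  using chebU_sin[of v "pi / real (2 * n + 1)"] sin_alpha_pos unfolding kap_def
  by (simp add: field_simps)

lemma kap_pos: "v < 2 * n \<Longrightarrow> kap v > 0"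
  using sin_angle_pos[of "v + 1"] sin_alpha_pos by (simp only: kap_eq) simp

lemma kap_reflect: "v < 2 * n \<Longrightarrow> kap (2 * n - 1 - v) = kap v"
proof -
  assume v: "v < 2 * n"
  have "real (2 * n - 1 - v + 1) * (pi / real (2 * n + 1)) = pi - real (v + 1) * (pi / real (2 * n + 1))"
    using v by (simp add: of_nat_diff field_simps)
  then show ?thesis unfolding kap_eq by (simp only: sin_pi_minus)
qed

lemma kap_top: "kap (2 * n) = 0"
  by (simp add: kap_eq)

lemma kap_0: "kap 0 = 1" by (simp add: kap_def)

text \<open>The weights form an eigenvector of the adjacency matrix. The defining recurrence covers
  the interior; beyond the ends it continues with weight 0, by \<open>kap_top\<close> on the right
  and by U_{-1} = 0 on the left.\<close>

lemma kap_neighbours: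
  assumes "j < 2 * n"
  shows "(if j > 0 then kap (j - 1) else 0) + (if j + 1 < 2 * n then kap (j + 1) else 0) =
    2 * cos (pi / real (2 * n + 1)) * kap j"
proof -
  have "(if j + 1 < 2 * n then kap (j + 1) else 0) = kap (j + 1)"
    using assms kap_top by (cases "j + 1 = 2 * n") auto
  moreover have "(if j > 0 then kap (j - 1) else 0) + kap (j + 1) = 2 * cos (pi / real (2 * n + 1)) * kap j"
    by (cases j) (simp_all add: kap_def)
  ultimately show ?thesis by simp
qed

text \<open>The sine increases up to a right angle, so weights exceed 1 at vertices strictly between
  0 and \<open>n\<close>; \<open>kap_reflect\<close> covers the other half. As 0 is even and
  \<open>2 * n - 1\<close> odd, each fibre has a unique vertex of weight 1.\<close>

lemma kap_eq_1_iff: "v < 2 * n \<Longrightarrow> kap v = 1 \<longleftrightarrow> v = 0 \<or> v = 2 * n - 1"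
proof
  have gt: "kap v > 1" if "0 < v" "v < n" for v
  proof -
    have "sin (pi / real (2 * n + 1)) < sin (real (v + 1) * (pi / real (2 * n + 1)))"
    proof (rule sin_monotone_2pi)
      show "- (pi / 2) \<le> pi / real (2 * n + 1)"
        by (rule order_trans[of _ 0]) simp_all
      have "1 * (pi / real (2 * n + 1)) < real (v + 1) * (pi / real (2 * n + 1))"
        using that by (intro mult_strict_right_mono) auto
      then show "pi / real (2 * n + 1) < real (v + 1) * (pi / real (2 * n + 1))" by simp
      have "real (v + 1) * 2 * pi \<le> real (2 * n + 1) * pi"
        using that by (intro mult_right_mono) auto
      then show "real (v + 1) * (pi / real (2 * n + 1)) \<le> pi / 2"
        by (simp add: field_simps)
    qed
    then show ?thesis using sin_alpha_pos by (simp only: kap_eq) simp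
  qed
  assume v: "v < 2 * n" and "kap v = 1"
  show "v = 0 \<or> v = 2 * n - 1"
  proof (rule ccontr)
    assume "\<not> (v = 0 \<or> v = 2 * n - 1)"
    then have "0 < v \<and> v < n \<or> 0 < 2 * n - 1 - v \<and> 2 * n - 1 - v < n" using v by linarith
    then show False using gt[of v] gt[of "2 * n - 1 - v"] kap_reflect[OF v] \<open>kap v = 1\<close> by auto
  qed
next
  assume "v < 2 * n" "v = 0 \<or> v = 2 * n - 1"
  then show "kap v = 1" using kap_reflect[of 0] kap_0 n by auto
qed

text \<open>The matrix \<^term>\<open>cg x\<close> is \<open>U\<^sub>x(A/2)\<close> for the adjacency matrix \<open>A\<close> of the path with
  \<open>2n\<close> vertices: its entries are the truncated Clebsch-Gordan multiplicities.  Up to sign, the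
  \<open>C\<close>-matrices have the columns of \<open>U\<^sub>x + U\<^sub>x\<^sub>-\<^sub>1\<close>.  The two boundary cases continue the recurrence
  \<open>cg2 (x + 1) + cg2 (x - 1) = cg2 x * A\<close> of \<open>cg2_neighbours\<close>.\<close>

definition cg :: "int \<Rightarrow> nat \<Rightarrow> nat \<Rightarrow> real" where
  "cg x i j = (if \<bar>int i - int j\<bar> \<le> x \<and> x \<le> int i + int j \<and> x \<le> 4 * int n - 2 - int i - int j
      \<and> even (x + int i + int j) then 1 else 0)"

definition cg2 :: "int \<Rightarrow> nat \<Rightarrow> nat \<Rightarrow> real" where
  "cg2 x i j = (if x = -1 then - cg 0 i j else if x = 2 * int n + 1 then - cg (2 * int n - 1) i j
     else cg x i j + cg (x - 1) i j)"

text \<open>The recurrence 2y U_x = U_{x+1} + U_{x-1} at 2y = A, reduced to a comparison of four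
  indicator functions.\<close>

lemma cg_neighbours:
  assumes "i < 2 * n" "j < 2 * n" "0 \<le> x" "x \<le> 2 * int n - 1"
  shows "(if j > 0 then cg x i (j - 1) else 0) + (if j + 1 < 2 * n then cg x i (j + 1) else 0) =
    cg (x + 1) i j + cg (x - 1) i j"
proof -
  \<comment> \<open>Integer indices admit the columns -1 and \<open>2 * n\<close>, where the bounds
    on \<open>x\<close> contradict each other; so the guards at both ends of the path
    disappear.\<close>
  define cgi where "cgi x i j = (if \<bar>i - j\<bar> \<le> x \<and> x \<le> i + j \<and> x \<le> 4 * int n - 2 - i - j
      \<and> even (x + i + j) then 1 else 0 :: real)" for x i j
  have 1: "(if j > 0 then cg x i (j - 1) else 0) = cgi x (int i) (int j - 1)"
    using assms by (cases j) (auto simp: cg_def cgi_def)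
  have 2: "(if j + 1 < 2 * n then cg x i (j + 1) else 0) = cgi x (int i) (int j + 1)"
    using assms by (auto simp: cg_def cgi_def)
  have 3: "cg x i j = cgi x (int i) (int j)" for x by (simp add: cg_def cgi_def)
  have "cgi x (int i) (int j - 1) + cgi x (int i) (int j + 1) =
      cgi (x + 1) (int i) (int j) + cgi (x - 1) (int i) (int j)"
  proof -
    define z where "z = x + int i + int j"
    have shift: "x + 1 + int i + int j = z + 1" "x - 1 + int i + int j = z - 1"
      "x + int i + (int j - 1) = z - 1" "x + int i + (int j + 1) = z + 1"
      by (simp_all add: z_def)
    show ?thesis
    proof (cases "even z")
    case True
    have zero: "cgi y a b = 0" if "odd (y + a + b)" for y a b
      using that by (simp add: cgi_def)
    have odds: "odd (x + 1 + int i + int j)" "odd (x - 1 + int i + int j)"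
      "odd (x + int i + (int j - 1))" "odd (x + int i + (int j + 1))" unfolding shift using True by simp_all
    show ?thesis by (simp only: odds[THEN zero])
  next
    case False
    obtain q where "x + int i + int j = 2 * q + 1" using False unfolding z_def by (rule oddE)
    then have q: "x = 2 * q + 1 - int i - int j" by linarith
    \<comment> \<open>Substituting \<open>q\<close> removes the parity conditions and leaves linear
      ones. Which term on the left matches which on the right varies, so conjunctions and
      disjunctions are compared; together they determine the sum of two indicators.\<close>
    define A B C D where "A \<longleftrightarrow> int i \<le> q \<and> int j \<le> q + 1 \<and> q + 1 \<le> int i + int j \<and> q \<le> 2 * int n - 1"
      and "B \<longleftrightarrow> int i \<le> q + 1 \<and> int j \<le> q \<and> q \<le> int i + int j \<and> q \<le> 2 * int n - 2"
      and "C \<longleftrightarrow> int i \<le> q + 1 \<and> int j \<le> q + 1 \<and> q + 1 \<le> int i + int j \<and> q \<le> 2 * int n - 2"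
      and "D \<longleftrightarrow> int i \<le> q \<and> int j \<le> q \<and> q \<le> int i + int j \<and> q \<le> 2 * int n - 1"
    have "0 \<le> int i" "0 \<le> int j" "int i < 2 * int n" "int j < 2 * int n" using assms by linarith+
    then have ABCD: "(A \<and> B \<longleftrightarrow> C \<and> D) \<and> (A \<or> B \<longleftrightarrow> C \<or> D)"
      using assms(3,4) unfolding A_def B_def C_def D_def q by linarith
    have evens: "even (x + 1 + int i + int j)" "even (x - 1 + int i + int j)"
      "even (x + int i + (int j - 1))" "even (x + int i + (int j + 1))" unfolding shift using False by simp_all
    have "cgi x (int i) (int j - 1) = (if A then 1 else 0)"
      unfolding cgi_def A_def by (rule if_cong[OF _ refl refl]) (use q evens(3) in linarith)
    moreover have "cgi x (int i) (int j + 1) = (if B then 1 else 0)"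
      unfolding cgi_def B_def by (rule if_cong[OF _ refl refl]) (use q evens(4) in linarith)
    moreover have "cgi (x + 1) (int i) (int j) = (if C then 1 else 0)"
      unfolding cgi_def C_def by (rule if_cong[OF _ refl refl]) (use q evens(1) in linarith)
    moreover have "cgi (x - 1) (int i) (int j) = (if D then 1 else 0)"
      unfolding cgi_def D_def by (rule if_cong[OF _ refl refl]) (use q evens(2) in linarith)
    ultimately show ?thesis using ABCD by (auto split: if_splits)
    qed
  qed
  then show ?thesis unfolding 1 2 3 .
qed

lemma cg_nonneg: "cg x i j \<ge> 0"
  by (simp add: cg_def)

text \<open>For large \<open>x\<close>, adding the two upper bounds in \<open>cg\<close> gives
  \<open>2 * x <= 4 * n - 2\<close>. At \<open>x = 2 * n\<close> this reflects Cayley-Hamilton,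
  since U_{2n}(y/2) is the characteristic polynomial of the path.\<close>

lemma cg_outside:
  assumes "x < 0 \<or> 2 * int n \<le> x"
  shows "cg x i j = 0"
proof -
  have "\<not> (\<bar>int i - int j\<bar> \<le> x \<and> x \<le> int i + int j \<and> x \<le> 4 * int n - 2 - int i - int j)"
    using assms by linarith
  then show ?thesis unfolding cg_def by (intro if_not_P) blast
qed

text \<open>Inside the range two instances of \<open>cg_neighbours\<close> add up. The Chebyshev
  polynomials continue with U_{-2} = -U_0 and, at A/2, with U_{2n+1} = -U_{2n-1}, whereas the
  truncated \<open>cg\<close> is 0 there; the boundary values of \<open>cg2\<close> supply these
  terms.\<close>

lemma cg2_neighbours:
  assumes "i < 2 * n" "j < 2 * n" "0 \<le> x" "x \<le> 2 * int n"
  shows "(if j > 0 then cg2 x i (j - 1) else 0) + (if j + 1 < 2 * n then cg2 x i (j + 1) else 0) =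
    cg2 (x + 1) i j + cg2 (x - 1) i j"
proof -
  have cg2_eq: "cg2 y i q = cg y i q + cg (y - 1) i q" if "0 \<le> y" "y \<le> 2 * int n" for y q
    using that by (simp add: cg2_def)
  consider "x = 0" | "1 \<le> x" "x \<le> 2 * int n - 1" | "x = 2 * int n"
    using assms(3,4) by linarith
  then show ?thesis
  proof cases
    case 1
    have "cg2 x i q = cg 0 i q" for q using 1 cg2_eq[of 0 q] cg_outside by simp
    moreover have "cg2 (x + 1) i j + cg2 (x - 1) i j = cg (0 + 1) i j + cg (0 - 1) i j"
      using 1 cg_outside cg2_eq[of 1 j] n by (simp add: cg2_def[of "-1"])
    ultimately show ?thesis
      using cg_neighbours[OF assms(1,2), of 0] n by (simp only:)
  next
    case 2
    have "cg2 x i q = cg x i q + cg (x - 1) i q" for q using 2 cg2_eq[of x q] by simp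
    moreover have "cg2 (x + 1) i j + cg2 (x - 1) i j =
        (cg (x + 1) i j + cg (x - 1) i j) + (cg (x - 1 + 1) i j + cg (x - 1 - 1) i j)"
      using 2 cg2_eq[of "x + 1" j] cg2_eq[of "x - 1" j] by simp
    ultimately show ?thesis
      using cg_neighbours[OF assms(1,2), of x, symmetric] cg_neighbours[OF assms(1,2), of "x - 1", symmetric] 2
      by (simp only:) simp
  next
    case 3
    have "cg2 x i q = cg (2 * int n - 1) i q" for q using 3 cg2_eq[of x q] cg_outside n by simp
    moreover have "cg2 (x + 1) i j + cg2 (x - 1) i j = cg (2 * int n - 1 + 1) i j + cg (2 * int n - 1 - 1) i j"
      using 3 cg_outside cg2_eq[of "2 * int n - 1" j] n
      by (simp add: cg2_def[of "2 * int n + 1"])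
    ultimately show ?thesis
      using cg_neighbours[OF assms(1,2), of "2 * int n - 1"] n by (simp only:)
  qed
qed

lemma cg2_nonneg: "0 \<le> x \<Longrightarrow> x \<le> 2 * int n \<Longrightarrow> cg2 x i j \<ge> 0"
  by (simp add: cg2_def cg_nonneg)

lemma cg2_nonpos: "x = -1 \<or> x = 2 * int n + 1 \<Longrightarrow> cg2 x i j \<le> 0"
  by (auto simp: cg2_def cg_nonneg)

lemma cg2_initial: "cg2 0 i j = - cg2 (-1) i j"
  by (simp add: cg2_def cg_outside)

lemma cg2_final: "cg2 (2 * int n) i j = - cg2 (2 * int n + 1) i j"
  using n by (simp add: cg2_def cg_outside)

lemma cg2_0:
  assumes "i < 2 * n" "j < 2 * n"
  shows "cg2 0 i j = (if i = j then 1 else 0)"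
proof -
  have "0 \<le> 4 * int n - 2 - int i - int i" using assms by linarith
  then have "cg 0 i j = (if i = j then 1 else 0)" by (auto simp: cg_def)
  then show ?thesis by (simp add: cg2_def cg_outside)
qed

definition path_adj :: "nat \<Rightarrow> nat \<Rightarrow> real" where
  "path_adj i j = (if i + 1 = j \<or> j + 1 = i then 1 else 0)"

lemma sum_path_adj:
  assumes "j < 2 * n" "j mod 2 \<noteq> k" "k < 2"
  shows "(\<Sum>q\<in>{q. q < 2 * n \<and> q mod 2 = k}. f q * path_adj q j) =
    (if j > 0 then f (j - 1) else 0) + (if j + 1 < 2 * n then f (j + 1) else 0)"
proof -
  let ?K = "{q. q < 2 * n \<and> q mod 2 = k}"
  have fin: "finite ?K" by simp
  \<comment> \<open>The guard \<open>j > 0\<close> matters: for \<open>j = 0\<close> truncated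
    subtraction turns \<open>j - 1\<close> into 0.\<close>
  have "(\<Sum>q\<in>?K. f q * path_adj q j) =
      (\<Sum>q\<in>?K. (if q = j - 1 then if j > 0 then f (j - 1) else 0 else 0) + (if q = j + 1 then f (j + 1) else 0))"
  proof (rule sum.cong[OF refl])
    fix q
    consider "q + 1 = j" | "q = j + 1" | "q + 1 \<noteq> j" "q \<noteq> j + 1" by blast
    then show "f q * path_adj q j =
        (if q = j - 1 then if j > 0 then f (j - 1) else 0 else 0) + (if q = j + 1 then f (j + 1) else 0)"
      by cases (auto simp: path_adj_def)
  qed
  also have "\<dots> = (if j - 1 \<in> ?K then if j > 0 then f (j - 1) else 0 else 0) + (if j + 1 \<in> ?K then f (j + 1) else 0)"
    by (simp only: sum.distrib sum.delta[OF fin])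
  also have "\<dots> = (if j > 0 then f (j - 1) else 0) + (if j + 1 < 2 * n then f (j + 1) else 0)"
  proof -
    have "(j + 1) mod 2 = k" using assms(2,3) by (auto simp: mod_Suc)
    then have 1: "j + 1 \<in> ?K \<longleftrightarrow> j + 1 < 2 * n" by blast
    have "j - 1 \<in> ?K" if "j > 0"
    proof -
      have "(j - 1) mod 2 = k" using assms(2,3) that by (cases j) (auto simp: mod_Suc split: if_splits)
      then show ?thesis using assms(1) by simp
    qed
    then have 2: "(if j - 1 \<in> ?K then if j > 0 then f (j - 1) else 0 else 0) = (if j > 0 then f (j - 1) else 0)"
      by (cases "j > 0") (simp_all only: if_True if_False if_cancel)
    show ?thesis unfolding 1 2 ..
  qed
  finally show ?thesis .
qed

lemma path_adj_same_parity: "i mod 2 = j mod 2 \<Longrightarrow> path_adj i j = 0"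
  by (auto simp: path_adj_def mod_Suc split: if_splits)

text \<open>In a state, the columns of even and odd index are given by \<open>cg2\<close> at the positions
  \<open>p\<close> and \<open>r\<close>; mutation at one parity reflects the position of the other one.  The two diagonal
  pairs are the states in which no column is added.\<close>

definition admissible :: "int \<Rightarrow> int \<Rightarrow> bool" where
  "admissible p r \<longleftrightarrow> (\<bar>p - r\<bar> = 1 \<and> p \<in> {-1..2 * int n + 1} \<and> r \<in> {-1..2 * int n + 1}) \<or>
     (p = r \<and> p \<in> {-1, 2 * int n + 1})"

text \<open>\<open>s\<close> flips with each composite mutation, which reverses all arrows of the
  path.\<close>

definition path_state :: "(nat \<Rightarrow> nat \<Rightarrow> real) \<Rightarrow> (nat \<Rightarrow> nat \<Rightarrow> real) \<Rightarrow> bool" where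
  "path_state t l \<longleftrightarrow> (\<exists>s\<in>{1, -1}. \<exists>p. admissible (p 0) (p 1) \<and>
     (\<forall>i<2*n. \<forall>j<2*n. t i j = s * (-1) ^ (i mod 2) * path_adj i j \<and>
        l i j = s * (-1) ^ (j mod 2) * cg2 (p (j mod 2)) i j))"

text \<open>For \<open>p\<close> in the range, the recurrence exchanges the neighbours
  \<open>p + 1\<close> and \<open>p - 1\<close>, hence \<open>2 * p - r\<close>. At the ends nothing
  is added and the new column must be the negative of the old one; \<open>cg2_initial\<close> and
  \<open>cg2_final\<close> achieve this by exchanging 0 with -1 and \<open>2 * n\<close> with
  \<open>2 * n + 1\<close>.\<close>

lemma cg2_reflect:
  assumes "admissible p r"
  shows "\<exists>r'. admissible p r' \<and> (\<forall>i<2*n. \<forall>j<2*n. cg2 r i j + cg2 r' i j =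
    (if p \<in> {0..2 * int n} then cg2 (p + 1) i j + cg2 (p - 1) i j else 0))"
proof (cases "p \<in> {0..2 * int n}")
  case True
  then have "r = p + 1 \<or> r = p - 1" using assms by (auto simp: admissible_def)
  then show ?thesis using True
    by (intro exI[of _ "2 * p - r"]) (auto simp: admissible_def)
next
  case False
  then consider "p = -1" "r = 0 \<or> r = -1" | "p = 2 * int n + 1" "r = 2 * int n \<or> r = 2 * int n + 1"
    using assms by (fastforce simp: admissible_def)
  then show ?thesis
  proof cases
    case 1
    then show ?thesis
      by (intro exI[of _ "- 1 - r"]) (auto simp: admissible_def cg2_initial)
  next
    case 2
    then show ?thesis using n
      by (intro exI[of _ "4 * int n + 1 - r"]) (auto simp: admissible_def cg2_final)
  qed
qed

lemma path_state_mut_step: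
  assumes st: "path_state t l" and k: "k < 2"
  defines "K \<equiv> {q. q < 2 * n \<and> q mod 2 = k}"
  shows "path_state (mut_step K K t t) (mut_step {} K t l)"
proof -
  obtain s p where s: "s = 1 \<or> s = (-1::real)" and adm: "admissible (p 0) (p 1)"
    and t: "\<And>i j. i < 2 * n \<Longrightarrow> j < 2 * n \<Longrightarrow> t i j = s * (-1) ^ (i mod 2) * path_adj i j"
    and l: "\<And>i j. i < 2 * n \<Longrightarrow> j < 2 * n \<Longrightarrow> l i j = s * (-1) ^ (j mod 2) * cg2 (p (j mod 2)) i j"
    using st unfolding path_state_def by blast
  have k01: "k = 0 \<or> k = 1" using k by auto
  have sym: "admissible a b \<longleftrightarrow> admissible b a" for a b
    by (auto simp: admissible_def)
  have adm': "admissible (p k) (p (1 - k))" using adm sym k01 by auto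
  then have bounds: "p k \<in> {-1..2 * int n + 1}" by (auto simp: admissible_def)
  obtain r where r: "admissible (p k) r" and cg2_r: "\<And>i j. i < 2 * n \<Longrightarrow> j < 2 * n \<Longrightarrow>
      cg2 (p (1 - k)) i j + cg2 r i j =
      (if p k \<in> {0..2 * int n} then cg2 (p k + 1) i j + cg2 (p k - 1) i j else 0)"
    using cg2_reflect[OF adm'] by blast
  have other: "j mod 2 = 1 - k" if "j mod 2 \<noteq> k" for j :: nat
    using that k01 by auto
  have sg: "s * (-1) ^ (q mod 2) \<in> {1, -1}" for q :: nat using s by (cases "even q") auto
  have t_new: "mut_step K K t t i j = - s * (-1) ^ (i mod 2) * path_adj i j" if "i < 2 * n" "j < 2 * n" for i j
  proof (cases "i \<in> K \<or> j \<in> K")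
    case False
    then have par: "i mod 2 = 1 - k" "j mod 2 = 1 - k" using that other by (auto simp: K_def)
    \<comment> \<open>\<open>t i q\<close> and \<open>t q j\<close> have opposite signs or one of
      them vanishes; in both cases the mutation summand is 0.\<close>
    have "(\<Sum>q\<in>K. (\<bar>t i q\<bar> * t q j + t i q * \<bar>t q j\<bar>) / 2) = 0"
    proof (rule sum.neutral, rule ballI)
      fix q assume "q \<in> K"
      then have q: "q < 2 * n" "q mod 2 = k" by (auto simp: K_def)
      have "t i q = s * (-1) ^ (1 - k) * path_adj i q" "t q j = s * (-1) ^ k * path_adj q j"
        using that q par by (simp_all add: t)
      then show "(\<bar>t i q\<bar> * t q j + t i q * \<bar>t q j\<bar>) / 2 = 0"
        using s k01 by (auto simp: path_adj_def)
    qed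
    moreover have "t i j = 0" "path_adj i j = 0" using that par by (simp_all add: t path_adj_same_parity)
    ultimately show ?thesis using False by (simp add: mut_step_def)
  qed (use that in \<open>simp add: mut_step_def t\<close>)
  have l_new: "mut_step {} K t l i j = - s * (-1) ^ (j mod 2) * cg2 ((p(1 - k := r)) (j mod 2)) i j"
    if ij: "i < 2 * n" "j < 2 * n" for i j
  proof (cases "j \<in> K")
    case True
    moreover have "k \<noteq> 1 - k" using k01 by auto
    ultimately show ?thesis using ij by (simp add: mut_step_def l K_def)
  next
    case False
    then have par: "j mod 2 \<noteq> k" using ij by (simp add: K_def)
    \<comment> \<open>Both factors carry the same sign \<open>c\<close>. The summand is therefore
      \<open>c * cg2 (p k) i q * path_adj q j\<close> when \<open>cg2\<close> is nonnegative and 0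
      when it is nonpositive, and the position \<open>p k\<close> decides which.\<close>
    have "(\<Sum>q\<in>K. (\<bar>l i q\<bar> * t q j + l i q * \<bar>t q j\<bar>) / 2) =
        (\<Sum>q\<in>K. s * (-1) ^ k * ((if p k \<in> {0..2 * int n} then cg2 (p k) i q else 0) * path_adj q j))"
    proof (rule sum.cong[OF refl])
      fix q assume "q \<in> K"
      then have q: "q < 2 * n" "q mod 2 = k" by (auto simp: K_def)
      define c where "c = s * (-1) ^ k"
      have tl: "l i q = c * cg2 (p k) i q" "t q j = c * path_adj q j"
        using ij q by (simp_all add: t l c_def)
      have "path_adj q j \<ge> 0" by (simp add: path_adj_def)
      moreover have "cg2 (p k) i q \<ge> 0 \<and> p k \<in> {0..2 * int n} \<or> cg2 (p k) i q \<le> 0 \<and> p k \<notin> {0..2 * int n}"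
        using cg2_nonneg[of "p k" i q] cg2_nonpos[of "p k" i q] bounds by fastforce
      moreover have "c = 1 \<or> c = -1" using s k01 by (auto simp: c_def)
      ultimately show "(\<bar>l i q\<bar> * t q j + l i q * \<bar>t q j\<bar>) / 2 =
          s * (-1) ^ k * ((if p k \<in> {0..2 * int n} then cg2 (p k) i q else 0) * path_adj q j)"
        unfolding tl c_def[symmetric] by (auto simp: abs_mult)
    qed
    also have "\<dots> = s * (-1) ^ k * (cg2 (p (1 - k)) i j + cg2 r i j)"
      using cg2_neighbours[OF ij, of "p k"]
        sum_path_adj[OF ij(2) par k, of "\<lambda>q. if p k \<in> {0..2 * int n} then cg2 (p k) i q else 0"] cg2_r[OF ij]
      unfolding K_def sum_distrib_left[symmetric] by auto
    finally have "mut_step {} K t l i j =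
        s * (-1) ^ (1 - k) * cg2 (p (1 - k)) i j + s * (-1) ^ k * (cg2 (p (1 - k)) i j + cg2 r i j)"
      using False ij other[OF par] by (simp add: mut_step_def l)
    also have "\<dots> = - s * (-1) ^ (1 - k) * cg2 r i j"
      using k01 by (auto simp: algebra_simps)
    finally show ?thesis using other[OF par] by simp
  qed
  have "admissible ((p(1 - k := r)) 0) ((p(1 - k := r)) 1)"
    using r sym[of r "p k"] k01 by auto
  then show ?thesis
    unfolding path_state_def using t_new l_new s
    by (intro bexI[of _ "- s"] exI[of _ "p(1 - k := r)"]) auto
qed

lemma path_state_sign:
  assumes "path_state t l" "b < 2"
  shows "\<exists>e\<in>{1, -1::real}. \<forall>i<2*n. \<forall>j\<in>{j. j < 2 * n \<and> j mod 2 = b}. e * l i j \<ge> 0"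
    "\<exists>e\<in>{1, -1::real}. \<forall>i\<in>{i. i < 2 * n \<and> i mod 2 = b}. \<forall>j<2*n. e * t i j \<ge> 0"
    "\<forall>i\<in>{i. i < 2 * n \<and> i mod 2 = b}. \<forall>j\<in>{j. j < 2 * n \<and> j mod 2 = b}. t i j = 0"
proof -
  obtain s p where s: "s = 1 \<or> s = (-1::real)" and adm: "admissible (p 0) (p 1)"
    and t: "\<And>i j. i < 2 * n \<Longrightarrow> j < 2 * n \<Longrightarrow> t i j = s * (-1) ^ (i mod 2) * path_adj i j"
    and l: "\<And>i j. i < 2 * n \<Longrightarrow> j < 2 * n \<Longrightarrow> l i j = s * (-1) ^ (j mod 2) * cg2 (p (j mod 2)) i j"
    using assms(1) unfolding path_state_def by blast
  have b01: "b = 0 \<or> b = 1" using assms(2) by auto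
  then have "p b \<in> {-1..2 * int n + 1}" using adm by (auto simp: admissible_def)
  then consider "\<And>i j. cg2 (p b) i j \<ge> 0" | "\<And>i j. cg2 (p b) i j \<le> 0"
    using cg2_nonneg[of "p b"] cg2_nonpos[of "p b"] by fastforce
  then obtain e where e: "e = 1 \<or> e = (-1::real)" "\<And>i j. e * cg2 (p b) i j \<ge> 0"
  proof cases
    case 1
    then show thesis using that[of 1] by simp
  next
    case 2
    then show thesis using that[of "-1"] by simp
  qed
  define c where "c = s * (-1) ^ b"
  have c: "c = 1 \<or> c = -1" using s b01 by (auto simp: c_def)
  have "c * e * l i j \<ge> 0" if "i < 2 * n" "j < 2 * n" "j mod 2 = b" for i j
    using l[OF that(1,2)] that(3) e(2)[of i j] c by (auto simp: c_def[symmetric])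
  then show "\<exists>e\<in>{1, -1::real}. \<forall>i<2*n. \<forall>j\<in>{j. j < 2 * n \<and> j mod 2 = b}. e * l i j \<ge> 0"
    using c e(1) by (intro bexI[of _ "c * e"]) auto
  have "c * t i j \<ge> 0" if "i < 2 * n" "j < 2 * n" "i mod 2 = b" for i j
    using t[OF that(1,2)] that(3) c by (auto simp: c_def[symmetric] path_adj_def)
  then show "\<exists>e\<in>{1, -1::real}. \<forall>i\<in>{i. i < 2 * n \<and> i mod 2 = b}. \<forall>j<2*n. e * t i j \<ge> 0"
    using c by (intro bexI[of _ c]) auto
  show "\<forall>i\<in>{i. i < 2 * n \<and> i mod 2 = b}. \<forall>j\<in>{j. j < 2 * n \<and> j mod 2 = b}. t i j = 0"
    by (simp add: t path_adj_same_parity)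
qed

lemma path_state_initial: "path_state (fS (FoldI n s)) (\<lambda>i j. if i = j then 1 else 0)"
proof -
  define c :: real where "c = (if s then 1 else -1)"
  \<comment> \<open>An identity column is \<open>cg2 0\<close> and also \<open>- cg2 (-1)\<close>;
    \<open>p\<close> selects the one that compensates the sign \<open>c * (-1) ^ b\<close>.\<close>
  define p :: "nat \<Rightarrow> int" where "p b = (if (b = 0) = s then 0 else -1)" for b
  have "fS (FoldI n s) i j = c * (-1) ^ (i mod 2) * path_adj i j" if "i < 2 * n" "j < 2 * n" for i j
    using that by (cases "even i") (auto simp: path_adj_def c_def even_iff_mod_2_eq_zero odd_iff_mod_2_eq_one)
  moreover have "(if i = j then 1 else 0) = c * (-1) ^ (j mod 2) * cg2 (p (j mod 2)) i j"
    if "i < 2 * n" "j < 2 * n" for i j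
    using cg2_0[OF that] cg2_initial[of i j]
    by (cases "even j") (auto simp: c_def p_def even_iff_mod_2_eq_zero odd_iff_mod_2_eq_one)
  moreover have "admissible (p 0) (p 1)" by (auto simp: admissible_def p_def)
  ultimately show ?thesis unfolding path_state_def
    by (intro bexI[of _ c] exI[of _ p]) (auto simp: c_def)
qed

lemma fold_pair_FoldI: "fold_pair (2 * n) 2 (\<lambda>v. v mod 2) kap (\<lambda>b. if b = 0 then 0 else 2 * n - 1)"
proof
  fix b :: nat assume "b < 2"
  moreover have "(2 * n - 1) mod 2 = 1" using n by (cases n) auto
  ultimately show "(if b = 0 then 0 else 2 * n - 1) < 2 * n \<and> (if b = 0 then 0 else 2 * n - 1) mod 2 = b \<and>
      kap (if b = 0 then 0 else 2 * n - 1) = 1"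
    using n kap_eq_1_iff[of 0] kap_eq_1_iff[of "2 * n - 1"] by auto
qed (simp_all add: kap_pos)

lemma theorem_FoldI:
  assumes "\<forall>k\<in>set ks. k < 2"
  shows "dF_mat (FoldI n s) (C_Delta (FoldI n s) ks) = C_Delta' (FoldI n s) ks
       \<and> (\<exists>G G'. mat_inverse (transpose_mat (C_Delta (FoldI n s) ks)) = Some G
              \<and> mat_inverse (transpose_mat (C_Delta' (FoldI n s) ks)) = Some G'
              \<and> dF_mat (FoldI n s) G = G')"
proof -
  interpret fold_pair "2 * n" 2 "\<lambda>v. v mod 2" kap "\<lambda>b. if b = 0 then 0 else 2 * n - 1"
    by (rule fold_pair_FoldI)
  have fib_eq: "fib k = {q. q < 2 * n \<and> q mod 2 = k}" for k by (auto simp: fib_def)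
  let ?w = "2 * cos (pi / real (2 * n + 1))"
  have fS_eq: "fS (FoldI n s) i j = (if even i = s then 1 else -1) * path_adj i j" if "i < 2 * n" "j < 2 * n" for i j
    using that by (auto simp: path_adj_def)
  have path_adj_sym: "path_adj i j = path_adj j i" for i j by (auto simp: path_adj_def)
  have B': "fB' (FoldI n s) a b = (if a = b then 0 else (if (a = 0) = s then 1 else -1) * ?w)"
    if "a < 2" "b < 2" for a b
    using that by (auto simp: Let_def less_2_cases_iff)
  have sum_kap: "(\<Sum>i\<in>fib a. kap i * path_adj i j) = (if j mod 2 = a then 0 else ?w * kap j)"
    if "a < 2" "j < 2 * n" for a j
  proof (cases "j mod 2 = a")
    case True
    then show ?thesis by (auto simp: fib_eq path_adj_same_parity)
  next
    case False
    then show ?thesis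
      using sum_path_adj[OF that(2) False that(1), of kap] kap_neighbours[OF that(2)] by (simp add: fib_eq)
  qed
  have "related (fS (FoldI n s)) (fB' (FoldI n s))"
    unfolding related_def
  proof (intro conjI allI impI)
    fix a j assume a: "a < (2::nat)" and j: "j < 2 * n"
    have "(\<Sum>i\<in>fib a. kap i * fS (FoldI n s) i j) =
        (\<Sum>i\<in>fib a. (if (a = 0) = s then 1 else -1) * (kap i * path_adj i j))"
    proof (rule sum.cong[OF refl])
      fix i assume "i \<in> fib a"
      then have i: "i < 2 * n" "i mod 2 = a" by simp_all
      then have "even i \<longleftrightarrow> a = 0" by (simp only: even_iff_mod_2_eq_zero)
      then have "fS (FoldI n s) i j = (if (a = 0) = s then 1 else -1) * path_adj i j"
        using fS_eq[OF i(1) j] by (simp only:)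
      then show "kap i * fS (FoldI n s) i j = (if (a = 0) = s then 1 else -1) * (kap i * path_adj i j)"
        by (simp only: mult_ac)
    qed
    also have "\<dots> = (if (a = 0) = s then 1 else -1) * (if j mod 2 = a then 0 else ?w * kap j)"
      by (simp only: sum_distrib_left[symmetric] sum_kap[OF a j])
    also have "\<dots> = kap j * fB' (FoldI n s) a (j mod 2)"
      unfolding B'[OF a mod_less_divisor[OF zero_less_numeral]] by auto
    finally show "(\<Sum>i\<in>fib a. kap i * fS (FoldI n s) i j) = kap j * fB' (FoldI n s) a (j mod 2)" .
  next
    fix i b assume i: "i < 2 * n" and b: "b < (2::nat)"
    have "(\<Sum>j\<in>fib b. kap j * fS (FoldI n s) i j) =
        (\<Sum>j\<in>fib b. (if even i = s then 1 else -1) * (kap j * path_adj j i))"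
    proof (rule sum.cong[OF refl])
      fix j assume "j \<in> fib b"
      then have "j < 2 * n" by simp
      then have "fS (FoldI n s) i j = (if even i = s then 1 else -1) * path_adj j i"
        using fS_eq[OF i] path_adj_sym[of i j] by (simp only:)
      then show "kap j * fS (FoldI n s) i j = (if even i = s then 1 else -1) * (kap j * path_adj j i)"
        by (simp only: mult_ac)
    qed
    also have "\<dots> = (if even i = s then 1 else -1) * (if i mod 2 = b then 0 else ?w * kap i)"
      by (simp only: sum_distrib_left[symmetric] sum_kap[OF b i])
    also have "\<dots> = kap i * fB' (FoldI n s) (i mod 2) b"
      unfolding B'[OF mod_less_divisor[OF zero_less_numeral] b] by (auto simp: even_iff_mod_2_eq_zero)
    finally show "(\<Sum>j\<in>fib b. kap j * fS (FoldI n s) i j) = kap i * fB' (FoldI n s) (i mod 2) b" .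
  qed
  moreover have "rep_vertex (FoldI n s) b = (if b = 0 then 0 else 2 * n - 1)" if "b < 2" for b
    unfolding rep_vertex_def
  proof (rule the_equality)
    show "(if b = 0 then 0 else 2 * n - 1) < fN (FoldI n s) \<and> fF (FoldI n s) (if b = 0 then 0 else 2 * n - 1) = b \<and>
        fkappa (FoldI n s) (if b = 0 then 0 else 2 * n - 1) = 1"
      using rep[OF that] unfolding kap_def by simp
    fix j assume "j < fN (FoldI n s) \<and> fF (FoldI n s) j = b \<and> fkappa (FoldI n s) j = 1"
    then have j: "j < 2 * n" "j mod 2 = b" "kap j = 1" by (simp_all add: kap_def)
    then show "j = (if b = 0 then 0 else 2 * n - 1)"
      using kap_eq_1_iff[OF j(1)] n by (cases n) auto
  qed
  ultimately show ?thesis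
  proof (intro dF_C_G[where P = "\<lambda>t l t' l'. path_state t l"])
    fix t l t' l'
    assume st: "path_state t l" and rel: "related t t'" "related l l'"
    have "coherent t t'"
    proof (rule coherentI[OF rel(1)])
      fix a b assume "a < (2::nat)"
      from path_state_sign(2)[OF st this]
      show "\<exists>e\<in>{1, -1}. \<forall>i\<in>fib a. \<forall>j\<in>fib b. 0 \<le> e * t i j" unfolding fib_eq by blast
    qed
    moreover have "coherent l l'"
    proof (rule coherentI[OF rel(2)])
      fix a b assume "b < (2::nat)"
      from path_state_sign(1)[OF st this]
      show "\<exists>e\<in>{1, -1}. \<forall>i\<in>fib a. \<forall>j\<in>fib b. 0 \<le> e * l i j" unfolding fib_eq by blast
    qed
    moreover have "column_coherent l'"
      by (rule column_coherentI[OF rel(2)]) (unfold fib_eq, rule path_state_sign(1)[OF st])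
    \<comment> \<open>The diagonal block upstairs is zero, hence so is its weighted sum, and
      \<open>kap k\<close> is positive.\<close>
    moreover have "t' k k = 0" if k: "k < 2" for k
    proof -
      have "(\<Sum>i\<in>fib k. kap i * t i k) = kap k * t' k (k mod 2)"
        using rel(1) k n by (simp add: related_def)
      moreover have "(\<Sum>i\<in>fib k. kap i * t i k) = 0"
        using path_state_sign(3)[OF st k] k n by (intro sum.neutral) (simp add: fib_eq)
      ultimately show ?thesis using kap_pos[of k] k n by simp
    qed
    ultimately show "coherent t t' \<and> coherent l l' \<and> column_coherent l' \<and> (\<forall>k<2. t' k k = 0)"
      by blast
  next
    fix t l k assume "path_state t l" "k < (2::nat)"
    then show "path_state (mut_step (fib k) (fib k) t t) (mut_step {} (fib k) t l)"
      unfolding fib_eq by (rule path_state_mut_step)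
  next
    show "path_state (fS (FoldI n s)) (\<lambda>i j. if i = j then 1 else 0)" by (rule path_state_initial)
  qed (use assms in \<open>auto simp: kap_def\<close>)
qed

end

section \<open>Enumeration of the seeds of types H3 and H4\<close>

datatype ord = LT | EQ | GT

text \<open>A pair \<open>(a, b)\<close> of integers stands for \<open>a + b\<phi>\<close> with \<open>\<phi> = 2 cos(\<pi>/5)\<close>.\<close>

fun z_add :: "int \<times> int \<Rightarrow> int \<times> int \<Rightarrow> int \<times> int" where
  "z_add (a, b) (c, d) = (a + c, b + d)"

fun z_neg :: "int \<times> int \<Rightarrow> int \<times> int" where
  "z_neg (a, b) = (- a, - b)"

fun z_phi :: "int \<times> int \<Rightarrow> int \<times> int" where
  "z_phi (a, b) = (b, a + b)"

fun z_scale :: "bool \<Rightarrow> bool \<Rightarrow> int \<times> int \<Rightarrow> int \<times> int" where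
  "z_scale True False x = x"
| "z_scale True True x = z_phi x"
| "z_scale False False x = z_neg x"
| "z_scale False True x = z_neg (z_phi x)"

text \<open>By \<open>phi * phi = phi + 1\<close> the product \<open>b * d\<close> enters both
  coordinates. All branches compute this one formula; the tests for zero shorten evaluation.\<close>

fun z_mult_add :: "int \<times> int \<Rightarrow> int \<times> int \<Rightarrow> int \<times> int \<Rightarrow> int \<times> int" where
  "z_mult_add (a, b) (c, d) (e, f) = (if a = 0 then if b = 0 then (e, f) else (e + b * d, f + b * c + b * d)
     else if b = 0 then (e + a * c, f + a * d) else (e + a * c + b * d, f + a * d + b * c + b * d))"

text \<open>Stronger than nonnegativity of the real number: both coordinates reappear as entries
  upstairs, which must share one sign.\<close>

fun z_nonneg :: "int \<times> int \<Rightarrow> bool" where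
  "z_nonneg (a, b) \<longleftrightarrow> a \<ge> 0 \<and> b \<ge> 0"

type_synonym zvec = "(int \<times> int) list"

fun dot :: "zvec \<Rightarrow> zvec \<Rightarrow> int \<times> int" where
  "dot (x # v) (y # w) = z_mult_add x y (dot v w)"
| "dot _ _ = (0, 0)"

text \<open>A path quiver is a list of edges, with orientation and a flag for weight \<open>\<phi>\<close>; \<open>dual\<close> contracts
  its exchange matrix with a vector.\<close>

fun dual :: "(bool \<times> bool) list \<Rightarrow> int \<times> int \<Rightarrow> zvec \<Rightarrow> zvec" where
  "dual ((s, p) # q) x (a # b # v) = z_add x (z_scale (\<not> s) p b) # dual q (z_scale s p a) (b # v)"
| "dual _ x _ = [x]"

fun v_neg :: "zvec \<Rightarrow> zvec" where
  "v_neg [] = []"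
| "v_neg (x # v) = z_neg x # v_neg v"

fun v_phi :: "zvec \<Rightarrow> zvec" where
  "v_phi [] = []"
| "v_phi (x # v) = z_phi x # v_phi v"

fun v_add :: "zvec \<Rightarrow> zvec \<Rightarrow> zvec" where
  "v_add (x # v) (y # w) = z_add x y # v_add v w"
| "v_add _ _ = []"

fun v_nonneg :: "zvec \<Rightarrow> bool" where
  "v_nonneg [] = True"
| "v_nonneg (x # v) = (z_nonneg x \<and> v_nonneg v)"

text \<open>The result \<open>[]\<close> signals an exchange matrix entry that is not covered by the
  certified cases; such a seed is rejected by \<open>v_good\<close>.\<close>

fun v_update :: "int \<times> int \<Rightarrow> zvec \<Rightarrow> zvec \<Rightarrow> zvec" where
  "v_update (a, b) v w = (if a = 0 then if b = 1 then v_add w (v_phi v) else if b \<le> 0 then w else []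
     else if a = 1 then if b = 0 then v_add w v else []
     else if a \<le> 0 then if b \<le> 0 then w else [] else [])"

text \<open>For a c-vector \<open>v\<close> of sign \<open>e\<close>, the product of this row with a
  c-vector \<open>w\<close> is \<open>e\<close> times the exchange matrix entry at \<open>v\<close>
  and \<open>w\<close>. Its positive part is the multiple of \<open>v\<close> that mutation adds to
  \<open>w\<close>.\<close>

definition signed_dual :: "(bool \<times> bool) list \<Rightarrow> zvec \<Rightarrow> zvec" where
  "signed_dual q v = (if v_nonneg v then dual q (0, 0) v else v_neg (dual q (0, 0) v))"

definition v_mutate :: "zvec \<Rightarrow> zvec \<Rightarrow> zvec \<Rightarrow> zvec" where
  "v_mutate u v w = v_update (dot u w) v w"

fun v_cmp :: "zvec \<Rightarrow> zvec \<Rightarrow> ord" where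
  "v_cmp [] [] = EQ"
| "v_cmp [] _ = LT"
| "v_cmp _ [] = GT"
| "v_cmp ((a, b) # v) ((c, d) # w) =
     (if a = c then if b = d then v_cmp v w else if b < d then LT else GT else if a < c then LT else GT)"

fun v_insert :: "zvec \<Rightarrow> zvec list \<Rightarrow> zvec list" where
  "v_insert x [] = [x]"
| "v_insert x (y # ys) = (case v_cmp x y of GT \<Rightarrow> y # v_insert x ys | _ \<Rightarrow> x # y # ys)"

fun v_sort :: "zvec list \<Rightarrow> zvec list" where
  "v_sort [] = []"
| "v_sort (x # xs) = v_insert x (v_sort xs)"

fun s_cmp :: "zvec list \<Rightarrow> zvec list \<Rightarrow> ord" where
  "s_cmp [] [] = EQ"
| "s_cmp [] _ = LT"
| "s_cmp _ [] = GT"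
| "s_cmp (v # s) (w # t) = (case v_cmp v w of EQ \<Rightarrow> s_cmp s t | LT \<Rightarrow> LT | GT \<Rightarrow> GT)"

fun v_mutates :: "zvec \<Rightarrow> zvec \<Rightarrow> zvec list \<Rightarrow> zvec list \<Rightarrow> zvec list" where
  "v_mutates u v [] ys = ys"
| "v_mutates u v (w # ws) ys = v_mutate u v w # v_mutates u v ws ys"

text \<open>Sorting yields a canonical list for each multiset of c-vectors, so seeds that differ by
  a relabelling become equal.\<close>

definition successor :: "zvec \<Rightarrow> zvec \<Rightarrow> zvec list \<Rightarrow> zvec list \<Rightarrow> zvec list" where
  "successor u v zs s = v_sort (v_mutates u v zs (v_neg v # v_mutates u v s []))"

fun successors :: "(bool \<times> bool) list \<Rightarrow> zvec list \<Rightarrow> zvec list \<Rightarrow> zvec list list" where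
  "successors q zs [] = []"
| "successors q zs (v # s) = successor (signed_dual q v) v zs s # successors q (v # zs) s"

definition v_good :: "zvec \<Rightarrow> bool" where
  "v_good v = (if v = [] then False else if v_nonneg v then True else v_nonneg (v_neg v))"

fun s_good :: "zvec list \<Rightarrow> bool" where
  "s_good [] = True"
| "s_good (v # s) = (v_good v \<and> s_good s)"

datatype tree = Leaf | Node tree "zvec list" tree

fun t_member :: "tree \<Rightarrow> zvec list \<Rightarrow> bool" where
  "t_member Leaf x = False"
| "t_member (Node l y r) x = (case s_cmp x y of EQ \<Rightarrow> True | LT \<Rightarrow> t_member l x | GT \<Rightarrow> t_member r x)"

fun t_insert :: "tree \<Rightarrow> zvec list \<Rightarrow> tree" where
  "t_insert Leaf x = Node Leaf x Leaf"
| "t_insert (Node l y r) x =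
     (case s_cmp x y of LT \<Rightarrow> Node (t_insert l x) y r | _ \<Rightarrow> Node l y (t_insert r x))"

fun enqueue :: "zvec list list \<Rightarrow> zvec list list \<Rightarrow> tree \<Rightarrow> zvec list list \<times> tree" where
  "enqueue [] todo t = (todo, t)"
| "enqueue (x # xs) todo t = (if t_member t x then enqueue xs todo t else enqueue xs (x # todo) (t_insert t x))"

fun explore :: "nat \<Rightarrow> (bool \<times> bool) list \<Rightarrow> zvec list list \<Rightarrow> tree \<Rightarrow> tree option" where
  "explore 0 q todo t = None"
| "explore (Suc n) q [] t = Some t"
| "explore (Suc n) q (s # todo) t = (if s_good s
     then case enqueue (successors q [] s) todo t of (todo', t') \<Rightarrow> explore n q todo' t' else None)"

text \<open>The simplifier traverses the right-hand side of a rewrite rule again when it contains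
  \<open>if\<close> or \<open>case\<close>.  The following code equations dispatch on evaluated arguments instead, so that
  evaluation does not revisit the whole tree in each step.\<close>

definition "member_dispatch c l r x =
  (case c of EQ \<Rightarrow> True | LT \<Rightarrow> t_member l x | GT \<Rightarrow> t_member r x)"

definition "insert_dispatch c l y r x =
  (case c of LT \<Rightarrow> Node (t_insert l x) y r | _ \<Rightarrow> Node l y (t_insert r x))"

definition "enqueue_dispatch b x xs todo t =
  (if b then enqueue xs todo t else enqueue xs (x # todo) (t_insert t x))"

definition "explore_dispatch b n q p =
  (if b then case p of (todo, t) \<Rightarrow> explore n q todo t else None)"

lemma [code]:
  "t_member Leaf x = False"
  "t_member (Node l y r) x = member_dispatch (s_cmp x y) l r x"
  by (simp_all add: member_dispatch_def)

lemma [code]: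
  "member_dispatch EQ l r x = True"
  "member_dispatch LT l r x = t_member l x"
  "member_dispatch GT l r x = t_member r x"
  by (simp_all add: member_dispatch_def)

lemma [code]:
  "t_insert Leaf x = Node Leaf x Leaf"
  "t_insert (Node l y r) x = insert_dispatch (s_cmp x y) l y r x"
  by (simp_all add: insert_dispatch_def)

lemma [code]:
  "insert_dispatch EQ l y r x = Node l y (t_insert r x)"
  "insert_dispatch LT l y r x = Node (t_insert l x) y r"
  "insert_dispatch GT l y r x = Node l y (t_insert r x)"
  by (simp_all add: insert_dispatch_def)

lemma [code]:
  "enqueue [] todo t = (todo, t)"
  "enqueue (x # xs) todo t = enqueue_dispatch (t_member t x) x xs todo t"
  by (simp_all add: enqueue_dispatch_def)

lemma [code]:
  "enqueue_dispatch True x xs todo t = enqueue xs todo t"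
  "enqueue_dispatch False x xs todo t = enqueue xs (x # todo) (t_insert t x)"
  by (simp_all add: enqueue_dispatch_def)

lemma [code]:
  "explore 0 q todo t = None"
  "explore (Suc n) q [] t = Some t"
  "explore (Suc n) q (s # todo) t =
     explore_dispatch (s_good s) n q (enqueue (successors q [] s) todo t)"
  by (simp_all add: explore_dispatch_def)

lemma [code]:
  "explore_dispatch False n q p = None"
  "explore_dispatch True n q (todo, t) = explore n q todo t"
  by (simp_all add: explore_dispatch_def)

definition initial :: "nat \<Rightarrow> zvec list" where
  "initial m = map (\<lambda>j. map (\<lambda>i. if i = j then (1, 0) else (0, 0)) [0..<m]) [0..<m]"

definition explore_ok :: "nat \<Rightarrow> nat \<Rightarrow> (bool \<times> bool) list \<Rightarrow> bool" where
  "explore_ok n m q = (case explore n q [v_sort (initial m)] (Node Leaf (v_sort (initial m)) Leaf) of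
     None \<Rightarrow> False | Some _ \<Rightarrow> True)"

text \<open>Each seed costs one unit of fuel and the final empty worklist one more, so 40 and 300
  leave room for 32 and 280 seeds. The first components run through all orientations of the
  path.\<close>

lemma explore_ok_H3:
  "explore_ok 40 3 [(False, False), (False, True)]"
  "explore_ok 40 3 [(False, False), (True, True)]"
  "explore_ok 40 3 [(True, False), (False, True)]"
  "explore_ok 40 3 [(True, False), (True, True)]"
  by code_simp+

lemma explore_ok_H4_0: "explore_ok 300 4 [(False, False), (False, False), (False, True)]" by code_simp
lemma explore_ok_H4_1: "explore_ok 300 4 [(False, False), (False, False), (True, True)]" by code_simp
lemma explore_ok_H4_2: "explore_ok 300 4 [(False, False), (True, False), (False, True)]" by code_simp
lemma explore_ok_H4_3: "explore_ok 300 4 [(False, False), (True, False), (True, True)]" by code_simp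
lemma explore_ok_H4_4: "explore_ok 300 4 [(True, False), (False, False), (False, True)]" by code_simp
lemma explore_ok_H4_5: "explore_ok 300 4 [(True, False), (False, False), (True, True)]" by code_simp
lemma explore_ok_H4_6: "explore_ok 300 4 [(True, False), (True, False), (False, True)]" by code_simp
lemma explore_ok_H4_7: "explore_ok 300 4 [(True, False), (True, False), (True, True)]" by code_simp

section \<open>Soundness of the exploration\<close>

lemma v_cmp_EQ: "v_cmp v w = EQ \<Longrightarrow> v = w"
  by (induction v w rule: v_cmp.induct) (auto split: if_splits)

lemma s_cmp_EQ: "s_cmp v w = EQ \<Longrightarrow> v = w"
  by (induction v w rule: s_cmp.induct) (auto split: ord.splits dest: v_cmp_EQ)

fun set_t :: "tree \<Rightarrow> zvec list set" where
  "set_t Leaf = {}"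
| "set_t (Node l y r) = insert y (set_t l \<union> set_t r)"

text \<open>Closure rests on positive answers being right: a seed missed by the search would merely
  be enqueued again.\<close>

lemma t_member_set: "t_member t x \<Longrightarrow> x \<in> set_t t"
  by (induction t) (auto split: ord.splits dest: s_cmp_EQ)

lemma set_t_insert: "set_t (t_insert t x) = insert x (set_t t)"
  by (induction t) (auto split: ord.splits)

lemma enqueue_set:
  assumes "enqueue xs todo t = (todo', t')"
  shows "set_t t' = set_t t \<union> set xs" "set todo \<subseteq> set todo'" "set xs \<subseteq> set_t t \<union> set todo'"
  using assms
  by (induction xs todo t arbitrary: todo' t' rule: enqueue.induct)
     (fastforce split: if_splits simp: set_t_insert dest: t_member_set)+

text \<open>The invariant is that seeds in the tree which no longer wait are good and have all
  successors in the tree. \<open>Some\<close> is reached with an empty worklist, when this covers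
  the whole tree.\<close>

lemma explore_closed:
  assumes "explore n q todo t = Some R"
    and "\<forall>x\<in>set_t t - set todo. s_good x \<and> set (successors q [] x) \<subseteq> set_t t"
  shows "set_t t \<subseteq> set_t R \<and> (\<forall>x\<in>set_t R. s_good x \<and> set (successors q [] x) \<subseteq> set_t R)"
  using assms
proof (induction n q todo t rule: explore.induct)
  case (3 n q s todo t)
  obtain todo' t' where e: "enqueue (successors q [] s) todo t = (todo', t')" by fastforce
  note e_set = enqueue_set[OF e]
  have good: "s_good s" and R: "explore n q todo' t' = Some R"
    using 3(2) e by (auto split: if_splits)
  have "\<forall>x\<in>set_t t' - set todo'. s_good x \<and> set (successors q [] x) \<subseteq> set_t t'"
  proof
    fix x assume "x \<in> set_t t' - set todo'"
    then have x: "x \<in> set_t t" "x \<notin> set todo" using e_set by auto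
    show "s_good x \<and> set (successors q [] x) \<subseteq> set_t t'"
      using 3(3) x good e_set(1) by (cases "x = s") auto
  qed
  then have "set_t t' \<subseteq> set_t R \<and> (\<forall>x\<in>set_t R. s_good x \<and> set (successors q [] x) \<subseteq> set_t R)"
    by (intro 3(1)[OF good e[symmetric] R])
  then show ?case using e_set(1) by auto
qed auto

lemma s_good_iff: "s_good s \<longleftrightarrow> (\<forall>v\<in>set s. v_good v)"
  by (induction s) auto

lemma mset_v_insert: "mset (v_insert x xs) = add_mset x (mset xs)"
  by (induction xs) (auto split: ord.splits)

lemma mset_v_sort: "mset (v_sort xs) = mset xs"
  by (induction xs) (auto simp: mset_v_insert)

lemma mset_v_mutates: "mset (v_mutates u v ws ys) = image_mset (v_mutate u v) (mset ws) + mset ys"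
  by (induction ws) auto

lemma successors_mset:
  "\<exists>s'\<in>set (successors q zs (xs @ v # ys)). mset s' =
     add_mset (v_neg v) (image_mset (v_mutate (signed_dual q v) v) (mset zs + mset xs + mset ys))"
proof (induction xs arbitrary: zs)
  case Nil
  show ?case by (simp add: successor_def mset_v_sort mset_v_mutates)
next
  case (Cons x xs)
  then show ?case using Cons.IH[of "x # zs"] by simp
qed

text \<open>An unlabelled seed is the multiset of its \<open>c\<close>-vectors: the exchange matrix is recovered from
  them as \<open>C\<^sup>T B C\<close> with the initial exchange matrix \<open>B\<close>.\<close>

definition seed_set :: "nat \<Rightarrow> (bool \<times> bool) list \<Rightarrow> zvec multiset set \<Rightarrow> bool" where
  "seed_set m q R \<longleftrightarrow> mset (initial m) \<in> R \<and> (\<forall>S\<in>R. (\<forall>v\<in>#S. v_good v) \<and>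
     (\<forall>v\<in>#S. add_mset (v_neg v) (image_mset (v_mutate (signed_dual q v) v) (S - {#v#})) \<in> R))"

lemma explore_ok_seed_set:
  assumes "explore_ok n m q"
  shows "\<exists>R. seed_set m q R"
proof -
  let ?s = "v_sort (initial m)"
  obtain t where t: "explore n q [?s] (Node Leaf ?s Leaf) = Some t"
    using assms by (auto simp: explore_ok_def split: option.splits)
  have R: "?s \<in> set_t t" "\<And>x. x \<in> set_t t \<Longrightarrow> s_good x" "\<And>x. x \<in> set_t t \<Longrightarrow> set (successors q [] x) \<subseteq> set_t t"
    using explore_closed[OF t] by auto
  have "seed_set m q (mset ` set_t t)"
    unfolding seed_set_def
  proof (intro conjI ballI)
    show "mset (initial m) \<in> mset ` set_t t"
      using imageI[OF R(1), of mset] by (simp add: mset_v_sort)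
  next
    fix S v assume "S \<in> mset ` set_t t" "v \<in># S"
    then obtain s where s: "s \<in> set_t t" "S = mset s" "v \<in> set s" by auto
    then show "v_good v" using R(2) by (auto simp: s_good_iff)
    obtain xs ys where split: "s = xs @ v # ys" using s(3) by (auto dest: split_list)
    obtain s' where "s' \<in> set (successors q [] s)" and
      s': "mset s' = add_mset (v_neg v) (image_mset (v_mutate (signed_dual q v) v) (mset xs + mset ys))"
      using successors_mset[of q "[]" xs v ys] split by auto
    then have "s' \<in> set_t t" using R(3)[OF s(1)] by auto
    moreover have "S - {#v#} = mset xs + mset ys" using s(2) split by simp
    ultimately show "add_mset (v_neg v) (image_mset (v_mutate (signed_dual q v) v) (S - {#v#})) \<in> mset ` set_t t"
      using s' by (metis imageI)
  qed
  then show ?thesis by blast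
qed

section \<open>The ring Z[phi] and its real values\<close>

definition phi :: real where "phi = 2 * cos (pi / 5)"

lemma phi_pos: "phi > 0"
  unfolding phi_def using cos_gt_zero[of "pi / 5"] by simp

lemma phi_square: "phi * phi = phi + 1"
proof -
  have s: "sin (pi / 5) > 0" by (rule sin_gt_zero) auto
  \<comment> \<open>Three times and twice this angle are supplementary, so their sines agree;
    cancelling the sine of the angle leaves the quadratic equation of \<open>phi\<close>.\<close>
  have "2 * (pi / 5) + pi / 5 = pi - 2 * (pi / 5)" by simp
  then have "sin (2 * (pi / 5) + pi / 5) = sin (2 * (pi / 5))" by (simp only: sin_pi_minus)
  then have "(2 * sin (pi / 5) * cos (pi / 5)) * cos (pi / 5) + (2 * (cos (pi / 5))\<^sup>2 - 1) * sin (pi / 5) =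
      2 * sin (pi / 5) * cos (pi / 5)"
    by (simp only: sin_add sin_double cos_double_cos)
  then have "sin (pi / 5) * (4 * (cos (pi / 5))\<^sup>2 - 1) = sin (pi / 5) * (2 * cos (pi / 5))"
    by (simp add: algebra_simps power2_eq_square)
  then have "4 * (cos (pi / 5))\<^sup>2 - 1 = 2 * cos (pi / 5)" using s by simp
  then show ?thesis by (simp add: phi_def power2_eq_square)
qed

definition zval :: "int \<times> int \<Rightarrow> real" where
  "zval x = of_int (fst x) + of_int (snd x) * phi"

text \<open>Irrationality of \<open>phi\<close> by descent: \<open>u = v * phi\<close> implies this
  equation, modulo 2 it forces \<open>u\<close> and \<open>v\<close> to be even, and halving both
  preserves it.\<close>

lemma golden_descent: "(u :: int) * u = u * v + v * v \<Longrightarrow> u = 0 \<and> v = 0"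
proof (induction "nat \<bar>u\<bar> + nat \<bar>v\<bar>" arbitrary: u v rule: less_induct)
  case less
  have "even u \<and> even v"
  proof (rule ccontr)
    assume "\<not> (even u \<and> even v)"
    then have "odd (u * u - u * v - v * v)" by auto
    then show False using less.prems by simp
  qed
  then obtain a b where ab: "u = 2 * a" "v = 2 * b" by (auto elim!: evenE)
  have eq: "a * a = a * b + b * b" using less.prems by (simp add: ab)
  show ?case
  proof (rule ccontr)
    assume "\<not> ?case"
    then have "nat \<bar>a\<bar> + nat \<bar>b\<bar> < nat \<bar>u\<bar> + nat \<bar>v\<bar>" by (auto simp: ab)
    then have "a = 0 \<and> b = 0" using less.hyps eq by blast
    then show False using \<open>\<not> ?case\<close> ab by simp
  qed
qed

lemma zval_inj: "zval x = zval y \<longleftrightarrow> x = y"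
proof
  assume eq: "zval x = zval y"
  define u v where "u = fst x - fst y" and "v = snd y - snd x"
  have uv: "of_int u = of_int v * phi"
    using eq by (simp add: zval_def u_def v_def algebra_simps)
  have "real_of_int (u * u) = of_int v * of_int v * (phi * phi)"
    by (simp add: uv algebra_simps)
  also have "\<dots> = of_int (u * v + v * v)"
    unfolding phi_square by (simp add: uv algebra_simps)
  finally have "u * u = u * v + v * v" by (simp only: of_int_eq_iff)
  then have "u = 0 \<and> v = 0" by (rule golden_descent)
  then show "x = y" by (simp add: u_def v_def prod_eq_iff)
qed simp

lemma zval_simps:
  "zval (0, 0) = 0" "zval (1, 0) = 1" "zval (0, 1) = phi"
  "zval (z_add x y) = zval x + zval y"
  "zval (z_neg x) = - zval x"
  "zval (z_phi x) = phi * zval x"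
  "zval (z_scale s p x) = (if s then 1 else -1) * (if p then phi else 1) * zval x"
  "zval (z_mult_add x y z) = zval x * zval y + zval z"
proof -
  show *: "zval (z_add x y) = zval x + zval y" "zval (z_neg x) = - zval x" for x y
    by (cases x; cases y; simp add: zval_def algebra_simps)+
  show phi: "zval (z_phi x) = phi * zval x" for x
  proof -
    obtain a b where x: "x = (a, b)" by (cases x)
    have "phi * zval x = of_int a * phi + of_int b * (phi * phi)"
      by (simp add: x zval_def algebra_simps)
    then show ?thesis unfolding phi_square by (simp add: x zval_def algebra_simps)
  qed
  show "zval (z_scale s p x) = (if s then 1 else -1) * (if p then phi else 1) * zval x"
    by (cases s; cases p; simp add: * phi)
  obtain a b c d e f where xyz: "x = (a, b)" "y = (c, d)" "z = (e, f)"
    by (metis surj_pair)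
  have "zval x * zval y = of_int (a * c) + of_int (a * d + b * c) * phi + of_int (b * d) * (phi * phi)"
    by (simp add: xyz zval_def algebra_simps)
  then have "zval x * zval y = of_int (a * c + b * d) + of_int (a * d + b * c + b * d) * phi"
    unfolding phi_square by (simp add: algebra_simps)
  then show "zval (z_mult_add x y z) = zval x * zval y + zval z"
    by (simp add: xyz zval_def algebra_simps)
qed (simp_all add: zval_def)

declare z_add.simps [simp del] z_neg.simps [simp del] z_phi.simps [simp del]
  z_mult_add.simps [simp del] z_scale.simps [simp del]

lemma zval_nonneg: "z_nonneg x \<Longrightarrow> zval x \<ge> 0"
  using phi_pos by (cases x) (simp add: zval_def)

lemma zval_v_neg: "i < length v \<Longrightarrow> zval (v_neg v ! i) = - zval (v ! i)"
  by (induction v arbitrary: i) (auto simp: zval_simps less_Suc_eq_0_disj)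

lemma zval_v_phi: "i < length v \<Longrightarrow> zval (v_phi v ! i) = phi * zval (v ! i)"
  by (induction v arbitrary: i) (auto simp: zval_simps less_Suc_eq_0_disj)

lemma length_v_neg [simp]: "length (v_neg v) = length v"
  by (induction v) auto

lemma length_v_phi [simp]: "length (v_phi v) = length v"
  by (induction v) auto

lemma length_v_add [simp]: "length (v_add v w) = min (length v) (length w)"
  by (induction v w rule: v_add.induct) auto

lemma zval_v_add:
  "i < length v \<Longrightarrow> i < length w \<Longrightarrow> zval (v_add v w ! i) = zval (v ! i) + zval (w ! i)"
  by (induction v w arbitrary: i rule: v_add.induct) (auto simp: zval_simps less_Suc_eq_0_disj)

lemma v_nonneg_nth: "v_nonneg v \<Longrightarrow> i < length v \<Longrightarrow> z_nonneg (v ! i)"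
  by (induction v arbitrary: i) (auto simp: less_Suc_eq_0_disj)

lemma zval_dot_v_neg: "zval (dot (v_neg v) w) = - zval (dot v w)"
  by (induction v w rule: dot.induct) (simp_all add: zval_simps)

definition z_coherent :: "real \<Rightarrow> bool" where
  "z_coherent r \<longleftrightarrow> (\<exists>x. r = zval x \<and> (z_nonneg x \<or> z_nonneg (z_neg x)))"

lemma z_coherentI: "z_nonneg x \<or> z_nonneg (z_neg x) \<Longrightarrow> z_coherent (zval x)"
  unfolding z_coherent_def by blast

text \<open>A nonempty result is a certificate: it leaves \<open>x = (0, 1)\<close>,
  \<open>x = (1, 0)\<close> or both coordinates at most 0. The factor of \<open>v\<close> is the
  positive part of \<open>zval x\<close>.\<close>

lemma v_update_zval:
  assumes "v_update x v w \<noteq> []" "length v = m" "length w = m"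
  shows "z_coherent (zval x)" "length (v_update x v w) = m"
    "i < m \<Longrightarrow> zval (v_update x v w ! i) = zval (w ! i) + (\<bar>zval x\<bar> + zval x) / 2 * zval (v ! i)"
proof -
  obtain a b where x: "x = (a, b)" by (cases x)
  consider "x = (0, 1)" "v_update x v w = v_add w (v_phi v)"
    | "x = (1, 0)" "v_update x v w = v_add w v"
    | "z_nonneg (z_neg x)" "v_update x v w = w"
    using assms(1) by (auto simp: x z_neg.simps split: if_splits)
  note cs = this
  show "z_coherent (zval x)"
    using cs by cases (auto intro!: z_coherentI)
  show "length (v_update x v w) = m"
    using cs by cases (simp_all add: assms)
  show "zval (v_update x v w ! i) = zval (w ! i) + (\<bar>zval x\<bar> + zval x) / 2 * zval (v ! i)" if "i < m"
    using cs
  proof cases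
    case 1
    then show ?thesis using that assms phi_pos
      by (simp only:) (simp add: zval_v_add zval_v_phi zval_simps)
  next
    case 2
    then show ?thesis using that assms by (simp only:) (simp add: zval_v_add zval_simps)
  next
    case 3
    then have "zval x \<le> 0" using zval_nonneg[OF 3(1)] by (simp add: zval_simps)
    then show ?thesis unfolding 3(2) by simp
  qed
qed

section \<open>States of types H3 and H4 and the congruence for the exchange matrix\<close>

definition bform :: "nat \<Rightarrow> (nat \<Rightarrow> nat \<Rightarrow> real) \<Rightarrow> (nat \<Rightarrow> real) \<Rightarrow> (nat \<Rightarrow> real) \<Rightarrow> real" where
  "bform m B x y = (\<Sum>a<m. \<Sum>b<m. x a * B a b * y b)"

lemma bform_add:
  "bform m B (\<lambda>a. x a + c * x' a) y = bform m B x y + c * bform m B x' y"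
  "bform m B x (\<lambda>a. y a + c * y' a) = bform m B x y + c * bform m B x y'"
  by (simp_all add: bform_def distrib_left distrib_right sum.distrib sum_distrib_left mult_ac)

lemma bform_uminus:
  "bform m B (\<lambda>a. - x a) y = - bform m B x y"
  "bform m B x (\<lambda>a. - y a) = - bform m B x y"
  by (simp_all add: bform_def sum_negf)

lemma bform_cong:
  assumes "\<And>a. a < m \<Longrightarrow> x a = x' a" "\<And>a. a < m \<Longrightarrow> y a = y' a"
  shows "bform m B x y = bform m B x' y'"
  using assms by (simp add: bform_def)

lemma bform_skew:
  assumes "\<And>a b. B a b = - B b a"
  shows "bform m B x y = - bform m B y x"
proof -
  have "bform m B x y = (\<Sum>b<m. \<Sum>a<m. x a * B a b * y b)"
    unfolding bform_def by (rule sum.swap)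
  also have "\<dots> = (\<Sum>b<m. \<Sum>a<m. - (y b * B b a * x a))"
    by (intro sum.cong refl, subst assms) simp
  finally show ?thesis by (simp add: bform_def sum_negf)
qed

lemma bform_unit:
  assumes "i < m" "j < m"
  shows "bform m B (\<lambda>a. if a = i then 1 else 0) (\<lambda>b. if b = j then 1 else 0) = B i j"
proof -
  have "bform m B (\<lambda>a. if a = i then 1 else 0) (\<lambda>b. if b = j then 1 else 0) =
      (\<Sum>a<m. \<Sum>b<m. if b = j then (if a = i then B i j else 0) else 0)"
    unfolding bform_def by (intro sum.cong refl) auto
  then show ?thesis using assms by simp
qed

text \<open>\<open>col\<close> restores labels to a seed of \<open>R\<close>, since mutation
  sequences refer to vertices.\<close>

definition H_state :: "nat \<Rightarrow> (nat \<Rightarrow> nat \<Rightarrow> real) \<Rightarrow> zvec multiset set \<Rightarrow>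
    (nat \<Rightarrow> nat \<Rightarrow> real) \<Rightarrow> (nat \<Rightarrow> nat \<Rightarrow> real) \<Rightarrow> bool" where
  "H_state m B R t l \<longleftrightarrow> (\<exists>col. image_mset col (mset_set {..<m}) \<in> R \<and>
     (\<forall>j<m. length (col j) = m) \<and> (\<forall>i<m. \<forall>j<m. l i j = zval (col j ! i)) \<and>
     (\<forall>i<m. \<forall>j<m. t i j = bform m B (\<lambda>a. l a i) (\<lambda>a. l a j)))"

lemma mut_step_eq_add:
  assumes "\<bar>l i k\<bar> = e * l i k" "j \<noteq> k"
  shows "mut_step {} {k} t l i j = l i j + (\<bar>t k j\<bar> + e * t k j) / 2 * l i k"
  using assms by (simp add: mut_step_def field_simps)

locale seed_exploration =
  fixes m :: nat and B :: "nat \<Rightarrow> nat \<Rightarrow> real" and q R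
  assumes skew: "\<And>a b. B a b = - B b a"
    and dual: "\<And>v w. length v = m \<Longrightarrow> length w = m \<Longrightarrow>
      zval (dot (dual q (0, 0) v) w) = bform m B (\<lambda>a. zval (v ! a)) (\<lambda>a. zval (w ! a))"
    and R: "seed_set m q R"
begin

text \<open>Goodness of the seed gives the sign of column \<open>k\<close>. Goodness of the
  successor shows that no update returned \<open>[]\<close>, which certifies row \<open>k\<close> of
  \<open>t\<close>. The congruence for \<open>t\<close> survives because adding multiples of column
  \<open>k\<close> inside the bilinear form reproduces matrix mutation.\<close>

lemma H_state_mut_step:
  assumes st: "H_state m B R t l" and k: "k < m"
  shows "H_state m B R (mut_step {k} {k} t t) (mut_step {} {k} t l)"
    and "j < m \<Longrightarrow> z_coherent (t k j)" "t k k = 0"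
    and "i < m \<Longrightarrow> z_coherent (l i k)"
    and "\<exists>e. e \<noteq> 0 \<and> (\<forall>i<m. \<bar>l i k\<bar> = e * l i k)"
proof -
  obtain col where S: "image_mset col (mset_set {..<m}) \<in> R"
    and len: "\<And>j. j < m \<Longrightarrow> length (col j) = m"
    and l: "\<And>i j. i < m \<Longrightarrow> j < m \<Longrightarrow> l i j = zval (col j ! i)"
    and t: "\<And>i j. i < m \<Longrightarrow> j < m \<Longrightarrow> t i j = bform m B (\<lambda>a. l a i) (\<lambda>a. l a j)"
    using st unfolding H_state_def by blast
  define v where "v = col k"
  define u where "u = signed_dual q v"
  define e :: real where "e = (if v_nonneg v then 1 else -1)"
  define col' where "col' j = (if j = k then v_neg v else v_mutate u v (col j))" for j
  have t_skew: "t i j = - t j i" if "i < m" "j < m" for i j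
    unfolding t[OF that] t[OF that(2,1)] by (rule bform_skew[OF skew])
  show t_kk: "t k k = 0" using t_skew[OF k k] by simp
  have split: "mset_set {..<m} = add_mset k (mset_set ({..<m} - {k}))"
    using k by (simp add: mset_set.remove)
  have v: "v \<in># image_mset col (mset_set {..<m})" using k by (simp add: v_def)
  have "add_mset (v_neg v) (image_mset (v_mutate u v) (image_mset col (mset_set {..<m}) - {#v#})) \<in> R"
    using R S v unfolding seed_set_def u_def by blast
  moreover have "image_mset col' (mset_set ({..<m} - {k})) =
      image_mset (v_mutate u v) (image_mset col (mset_set ({..<m} - {k})))"
    unfolding multiset.map_comp by (intro image_mset_cong) (auto simp: col'_def)
  ultimately have S': "image_mset col' (mset_set {..<m}) \<in> R"
    unfolding split by (simp add: v_def col'_def)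
  have good: "v_good (col j)" "v_good (col' j)" if "j < m" for j
    using that S S' R unfolding seed_set_def by fastforce+
  have nn: "z_nonneg (v ! i) \<or> z_nonneg (z_neg (v ! i))" "e * zval (v ! i) \<ge> 0" if "i < m" for i
  proof -
    have neg_nth: "v_neg v ! i = z_neg (v ! i)" if "i < length v" for v i
      using that by (induction v arbitrary: i) (auto simp: less_Suc_eq_0_disj)
    have "v_nonneg v \<or> v_nonneg (v_neg v)"
      using good(1)[OF k] by (auto simp: v_def v_good_def split: if_splits)
    then have "z_nonneg (v ! i) \<and> e = 1 \<or> z_nonneg (z_neg (v ! i)) \<and> e = -1"
      using v_nonneg_nth[of v i] v_nonneg_nth[of "v_neg v" i] that len[OF k] neg_nth[of i v]
      by (auto simp: e_def v_def)
    then show "z_nonneg (v ! i) \<or> z_nonneg (z_neg (v ! i))" "e * zval (v ! i) \<ge> 0"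
      using zval_nonneg[of "v ! i"] zval_nonneg[of "z_neg (v ! i)"] by (auto simp: zval_simps)
  qed
  have e: "e = 1 \<or> e = -1" by (simp add: e_def)
  show "z_coherent (l i k)" if "i < m"
    using z_coherentI[OF nn(1)[OF that]] l[OF that k] by (simp add: v_def)
  have abs_l: "\<bar>l i k\<bar> = e * l i k" if "i < m" for i
    using nn(2)[OF that] l[OF that k] e by (auto simp: v_def)
  then show "\<exists>e. e \<noteq> 0 \<and> (\<forall>i<m. \<bar>l i k\<bar> = e * l i k)" using e by (intro exI[of _ e]) auto
  have dot_u: "zval (dot u (col j)) = e * t k j" if j: "j < m" for j
  proof -
    have "zval (dot (dual q (0, 0) v) (col j)) = bform m B (\<lambda>a. zval (v ! a)) (\<lambda>a. zval (col j ! a))"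
      using len[OF k] len[OF j] by (intro dual) (simp_all add: v_def)
    also have "\<dots> = t k j"
      unfolding t[OF k j] by (rule bform_cong) (simp_all add: l k j v_def)
    finally show ?thesis by (simp add: u_def signed_dual_def e_def zval_dot_v_neg)
  qed
  have upd: "v_update (dot u (col j)) v (col j) \<noteq> []" if "j < m" "j \<noteq> k" for j
    using good(2)[OF that(1)] that(2) by (auto simp: col'_def v_mutate_def v_good_def split: if_splits)
  have len_v: "length v = m" using len[OF k] by (simp add: v_def)
  show "z_coherent (t k j)" if j: "j < m"
  proof (cases "j = k")
    case True
    then show ?thesis using t_kk z_coherentI[of "(0, 0)"] by (simp add: zval_simps)
  next
    case False
    have "z_coherent (e * t k j)"
      using v_update_zval(1)[OF upd[OF j False] len_v len[OF j]] dot_u[OF j] by simp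
    then obtain x where x: "e * t k j = zval x" "z_nonneg x \<or> z_nonneg (z_neg x)"
      unfolding z_coherent_def by blast
    have "z_neg (z_neg x) = x" by (cases x) (simp add: z_neg.simps)
    moreover have "t k j = zval x \<or> t k j = zval (z_neg x)" using e x(1) by (auto simp: zval_simps)
    ultimately show ?thesis using x(2) unfolding z_coherent_def by metis
  qed
  let ?l = "mut_step {} {k} t l" and ?t = "mut_step {k} {k} t t"
  have l_k: "?l i k = - l i k" for i by (simp add: mut_step_def)
  have l_j: "?l i j = l i j + (\<bar>t k j\<bar> + e * t k j) / 2 * l i k" if "i < m" "j \<noteq> k" for i j
    using abs_l[OF that(1)] that(2) by (rule mut_step_eq_add)
  have "length (col' j) = m" if j: "j < m" for j
    using v_update_zval(2)[OF upd len_v len] j by (auto simp: col'_def len_v v_mutate_def)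
  moreover have "?l i j = zval (col' j ! i)" if i: "i < m" and j: "j < m" for i j
  proof (cases "j = k")
    case True
    then show ?thesis using i len_v l[OF i k] by (simp add: l_k col'_def zval_v_neg v_def[symmetric])
  next
    case False
    have "\<bar>e * t k j\<bar> = \<bar>t k j\<bar>" using e by auto
    then show ?thesis
      using v_update_zval(3)[OF upd[OF j False] len_v len[OF j] i] False
      by (simp add: l_j[OF i False] col'_def v_mutate_def dot_u[OF j] l[OF i j] l[OF i k] v_def)
  qed
  moreover have "?t i j = bform m B (\<lambda>a. ?l a i) (\<lambda>a. ?l a j)" if i: "i < m" and j: "j < m" for i j
  proof -
    define c where "c j = (\<bar>t k j\<bar> + e * t k j) / 2" for j
    have c: "bform m B (\<lambda>a. ?l a p) y = bform m B (\<lambda>a. l a p + c p * l a k) y"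
      "bform m B y (\<lambda>a. ?l a p) = bform m B y (\<lambda>a. l a p + c p * l a k)" if "p \<noteq> k" for p y
      using that by (intro bform_cong; simp add: l_j c_def)+
    show ?thesis
    proof (cases "i = k \<or> j = k")
      case True
      then consider "i = k" "j = k" | "i = k" "j \<noteq> k" | "i \<noteq> k" "j = k" by blast
      then show ?thesis
      proof cases
        case 1
        then show ?thesis using t[OF k k] t_kk by (simp add: mut_step_def l_k bform_uminus)
      next
        case 2
        then show ?thesis using t[OF k k] t[OF k j] t_kk
          by (simp add: l_k bform_uminus c bform_add) (simp add: mut_step_def)
      next
        case 3
        then show ?thesis using t[OF k k] t[OF i k] t_kk
          by (simp add: l_k bform_uminus c bform_add) (simp add: mut_step_def)
      qed
    next
      case False
      \<comment> \<open>After \<open>t i k = - t k i\<close> the two terms with \<open>e\<close>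
        cancel, which leaves the symmetric mutation formula.\<close>
      have "bform m B (\<lambda>a. ?l a i) (\<lambda>a. ?l a j) = t i j + c j * t i k + c i * t k j"
        using False t i j k t_kk by (simp add: c bform_add algebra_simps)
      also have "\<dots> = ?t i j"
        using False t_skew[OF i k] e unfolding mut_step_def c_def by (auto simp: field_simps)
      finally show ?thesis by simp
    qed
  qed
  ultimately show "H_state m B R ?t ?l"
    unfolding H_state_def using S' by blast
qed

lemma H_state_initial: "H_state m B R B (\<lambda>i j. if i = j then 1 else 0)"
proof -
  define col :: "nat \<Rightarrow> zvec" where "col j = map (\<lambda>i. if i = j then (1, 0) else (0, 0)) [0..<m]" for j
  have "mset (initial m) = image_mset col (mset_set {..<m})"
    by (simp add: initial_def col_def[abs_def] lessThan_atLeast0)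
  then have "image_mset col (mset_set {..<m}) \<in> R" using R by (simp add: seed_set_def)
  moreover have "length (col j) = m" for j by (simp add: col_def)
  moreover have "(if i = j then 1 else 0) = zval (col j ! i)" if "i < m" for i j
    using that by (simp add: col_def zval_simps)
  ultimately show ?thesis
    unfolding H_state_def using bform_unit[of _ m _ B] by (intro exI[of _ col]) simp
qed

end

section \<open>Folding D6 and E8\<close>

definition quiver :: "nat \<Rightarrow> (nat \<Rightarrow> bool) \<Rightarrow> (bool \<times> bool) list" where
  "quiver m ori = map (\<lambda>c. (ori c, c + 2 = m)) [0..<m - 1]"

lemma quiver_eq:
  "quiver 3 ori = [(ori 0, False), (ori 1, True)]"
  "quiver 4 ori = [(ori 0, False), (ori 1, False), (ori 2, True)]"
  by (simp_all add: quiver_def upt_rec numeral_2_eq_2)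

lemma seed_set_exists:
  assumes "m \<in> {3, 4}"
  shows "\<exists>R. seed_set m (quiver m ori) R"
proof -
  have "\<exists>n. explore_ok n m (quiver m ori)"
  proof (cases "m = 3")
    case True
    have "explore_ok 40 3 [(a, False), (b, True)]" for a b
      using explore_ok_H3 by (cases a; cases b) simp_all
    then show ?thesis using True by (auto simp: quiver_eq)
  next
    case False
    have "explore_ok 300 4 [(a, False), (b, False), (c, True)]" for a b c
      using explore_ok_H4_0 explore_ok_H4_1 explore_ok_H4_2 explore_ok_H4_3
        explore_ok_H4_4 explore_ok_H4_5 explore_ok_H4_6 explore_ok_H4_7
      by (cases a; cases b; cases c) simp_all
    then show ?thesis using False assms by (auto simp: quiver_eq)
  qed
  then show ?thesis using explore_ok_seed_set by blast
qed

lemma dual_bform: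
  assumes "m \<in> {3, 4}" "length v = m" "length w = m"
  shows "zval (dot (dual (quiver m ori) (0, 0) v) w) =
    bform m (fB' (FoldH m ori)) (\<lambda>a. zval (v ! a)) (\<lambda>a. zval (w ! a))"
proof (cases "m = 3")
  case True
  obtain v0 v1 v2 where v: "v = [v0, v1, v2]"
    using assms(2) True by (auto simp: length_Suc_conv numeral_3_eq_3)
  obtain w0 w1 w2 where w: "w = [w0, w1, w2]"
    using assms(3) True by (auto simp: length_Suc_conv numeral_3_eq_3)
  show ?thesis
    unfolding True quiver_eq v w bform_def
    by (simp add: zval_simps H_weight_def phi_def[symmetric] lessThan_Suc eval_nat_numeral algebra_simps)
next
  case False
  then have m: "m = 4" using assms(1) by simp
  obtain v0 v1 v2 v3 where v: "v = [v0, v1, v2, v3]"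
    using assms(2) m by (auto simp: length_Suc_conv eval_nat_numeral)
  obtain w0 w1 w2 w3 where w: "w = [w0, w1, w2, w3]"
    using assms(3) m by (auto simp: length_Suc_conv eval_nat_numeral)
  show ?thesis
    unfolding m quiver_eq v w bform_def
    by (simp add: zval_simps H_weight_def phi_def[symmetric] lessThan_Suc eval_nat_numeral algebra_simps)
qed

lemma fB'_skew: "fB' (FoldH m ori) a b = - fB' (FoldH m ori) b a"
  by auto

lemma H_edge_iff:
  "H_edge m a b \<longleftrightarrow> a + 3 \<le> m \<and> b = a + 1 \<or> m \<le> a \<and> a + 3 \<le> 2 * m \<and> b = a + 1 \<or>
     a = m - 2 \<and> b = 2 * m - 1 \<or> a = 2 * m - 2 \<and> b = m - 1 \<or> a = 2 * m - 2 \<and> b = 2 * m - 1"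
proof -
  have "(\<exists>c. c + 3 \<le> m \<and> a = m + c \<and> b = m + c + 1) \<longleftrightarrow> m \<le> a \<and> a + 3 \<le> 2 * m \<and> b = a + 1"
    by (auto intro!: exI[of _ "a - m"])
  then show ?thesis unfolding H_edge_def by blast
qed

lemma H_edge_3: "H_edge 3 a b \<longleftrightarrow> (a, b) \<in> {(0, 1), (3, 4), (1, 5), (4, 2), (4, 5)}"
proof -
  have 1: "a + 3 \<le> 3 \<and> b = a + 1 \<longleftrightarrow> a = 0 \<and> b = 1" by linarith
  have 2: "3 \<le> a \<and> a + 3 \<le> 2 * 3 \<and> b = a + 1 \<longleftrightarrow> a = 3 \<and> b = 4" by linarith
  show ?thesis unfolding H_edge_iff 1 2 by simp
qed

lemma H_edge_4: "H_edge 4 a b \<longleftrightarrow> (a, b) \<in> {(0, 1), (1, 2), (4, 5), (5, 6), (2, 7), (6, 3), (6, 7)}"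
proof -
  consider "a = 0" | "a = 1" | "a = 2" | "a = 3" | "a = 4" | "a = 5" | "a = 6" | "7 \<le> a"
    by linarith
  then show ?thesis
    by cases (simp_all add: H_edge_iff, simp add: numeral_2_eq_2)
qed

lemma all_less_6: "(\<forall>i<6. P i) \<longleftrightarrow> P 0 \<and> P 1 \<and> P 2 \<and> P 3 \<and> P 4 \<and> P (5::nat)"
proof
  assume *: "P 0 \<and> P 1 \<and> P 2 \<and> P 3 \<and> P 4 \<and> P (5::nat)"
  show "\<forall>i<6. P i"
  proof (intro allI impI)
    fix i :: nat assume "i < 6"
    then consider "i = 0" | "i = 1" | "i = 2" | "i = 3" | "i = 4" | "i = 5" by linarith
    then show "P i" using * by cases simp_all
  qed
qed simp

lemma all_less_8:
  "(\<forall>i<8. P i) \<longleftrightarrow> P 0 \<and> P 1 \<and> P 2 \<and> P 3 \<and> P 4 \<and> P 5 \<and> P 6 \<and> P (7::nat)"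
proof
  assume *: "P 0 \<and> P 1 \<and> P 2 \<and> P 3 \<and> P 4 \<and> P 5 \<and> P 6 \<and> P (7::nat)"
  show "\<forall>i<8. P i"
  proof (intro allI impI)
    fix i :: nat assume "i < 8"
    then consider "i = 0" | "i = 1" | "i = 2" | "i = 3" | "i = 4" | "i = 5" | "i = 6" | "i = 7"
      by linarith
    then show "P i" using * by cases simp_all
  qed
qed simp

definition H_kappa :: "nat \<Rightarrow> nat \<Rightarrow> real" where
  "H_kappa m v = (if v < m then 1 else phi)"

lemma H_edge_asym: "m \<ge> 3 \<Longrightarrow> H_edge m a b \<Longrightarrow> \<not> H_edge m b a"
  unfolding H_edge_iff by (intro notI, elim disjE) linarith+

lemma fS_skew: "m \<ge> 3 \<Longrightarrow> fS (FoldH m ori) a b = - fS (FoldH m ori) b a"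
  using H_edge_asym[of m a b] by (cases "H_edge m a b"; cases "H_edge m b a") simp_all

text \<open>Between the last two columns, at a vertex of weight \<open>phi\<close>, the claim reads
  \<open>1 + phi = phi * phi\<close> up to sign; the remaining cases match directly.\<close>

lemma fS_fold_3:
  assumes "a < 3"
  shows "\<forall>j<6. fS (FoldH 3 ori) a j + phi * fS (FoldH 3 ori) (3 + a) j =
     H_kappa 3 j * fB' (FoldH 3 ori) a (j mod 3)"
proof -
  consider "a = 0" | "a = 1" | "a = 2" using assms by linarith
  then show ?thesis
    unfolding all_less_6
    by cases (use phi_square in \<open>simp_all add: H_kappa_def H_edge_3 H_weight_def phi_def[symmetric]\<close>)
qed

lemma fS_fold_4:
  assumes "a < 4"
  shows "\<forall>j<8. fS (FoldH 4 ori) a j + phi * fS (FoldH 4 ori) (4 + a) j =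
     H_kappa 4 j * fB' (FoldH 4 ori) a (j mod 4)"
proof -
  consider "a = 0" | "a = 1" | "a = 2" | "a = 3" using assms by linarith
  then show ?thesis
    unfolding all_less_8
    by cases (use phi_square in \<open>simp_all add: H_kappa_def H_edge_4 H_weight_def phi_def[symmetric]\<close>)
qed

context
  fixes m :: nat
  assumes m: "m \<in> {3, 4}"
begin

lemma m_ge_3: "m \<ge> 3"
  using m by auto

lemma fold_pair_FoldH: "fold_pair (2 * m) m (\<lambda>v. v mod m) (H_kappa m) (\<lambda>b. b)"
  by unfold_locales (use m phi_pos in \<open>auto simp: H_kappa_def\<close>)

interpretation fold_pair "2 * m" m "\<lambda>v. v mod m" "H_kappa m" "\<lambda>b. b"
  by (rule fold_pair_FoldH)

lemma fib_H:
  assumes "a < m"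
  shows "fib a = {a, m + a}"
proof (rule Set.set_eqI)
  fix x
  have "x < 2 * m \<and> x mod m = a \<longleftrightarrow> x \<in> {a, m + a}"
  proof (cases "x < m")
    case False
    then obtain y where "x = m + y" using le_Suc_ex by (metis not_less)
    then show ?thesis using assms by auto
  qed (use assms in auto)
  then show "x \<in> fib a \<longleftrightarrow> x \<in> {a, m + a}" by (simp only: mem_fib)
qed

lemma sum_fib_H: "a < m \<Longrightarrow> (\<Sum>i\<in>fib a. H_kappa m i * f i) = f a + phi * f (m + a)"
  by (simp add: fib_H H_kappa_def)

lemma related_H: "related (fS (FoldH m ori)) (fB' (FoldH m ori))"
proof -
  have row: "fS (FoldH m ori) a j + phi * fS (FoldH m ori) (m + a) j =
      H_kappa m j * fB' (FoldH m ori) a (j mod m)" if "a < m" "j < 2 * m" for a j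
  proof (cases "m = 3")
    case True
    then show ?thesis using fS_fold_3[of a ori] that by simp
  next
    case False
    then have "m = 4" using m by simp
    then show ?thesis using fS_fold_4[of a ori] that by simp
  qed
  \<comment> \<open>Both exchange matrices are skew-symmetric, so this is the negated row
    relation.\<close>
  have col: "fS (FoldH m ori) i b + phi * fS (FoldH m ori) i (m + b) =
      H_kappa m i * fB' (FoldH m ori) (i mod m) b" if "b < m" "i < 2 * m" for i b
    using row[OF that] unfolding fS_skew[OF m_ge_3, of ori i] fB'_skew[of m ori "i mod m"] by simp
  show ?thesis
    unfolding related_def by (intro conjI allI impI) (simp_all only: sum_fib_H row col)
qed

text \<open>If \<open>l' a b\<close> is p + r phi, integrality and irrationality force the block to
  have rows (p, r) and (r, p + r): multiplication by \<open>l' a b\<close> on Z[phi]. The second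
  column belongs to \<open>m + b\<close>, whose weight \<open>phi\<close> turns x into
  \<open>z_phi x\<close>. When p and r share a sign, so do all four entries.\<close>

lemma coherent_H:
  assumes rel: "related l l'"
    and ints: "\<And>i j. i < 2 * m \<Longrightarrow> j < 2 * m \<Longrightarrow> l i j \<in> \<int>"
    and coh: "\<And>a b. a < m \<Longrightarrow> b < m \<Longrightarrow> z_coherent (l' a b)"
  shows "coherent l l'"
proof (rule coherentI[OF rel])
  fix a b assume ab: "a < m" "b < m"
  obtain x where x: "l' a b = zval x" "z_nonneg x \<or> z_nonneg (z_neg x)"
    using coh[OF ab] unfolding z_coherent_def by blast
  have row: "l a j + phi * l (m + a) j = H_kappa m j * l' a (j mod m)" if "j < 2 * m" for j
    using rel[unfolded related_def, THEN conjunct1, rule_format, OF ab(1) that]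
    unfolding sum_fib_H[OF ab(1)] .
  have entries: "l a j = of_int (fst y) \<and> l (m + a) j = of_int (snd y)"
    if "j < 2 * m" "l a j + phi * l (m + a) j = zval y" for j y
  proof -
    have j: "j < 2 * m" by (rule that(1))
    have "a < 2 * m" "m + a < 2 * m" using ab(1) by simp_all
    then obtain p r where pr: "l a j = of_int p" "l (m + a) j = of_int r"
      using ints[OF _ j] by (metis Ints_cases)
    then have "zval (p, r) = zval y" using that(2) by (simp add: zval_def mult.commute)
    then have "y = (p, r)" by (simp only: zval_inj)
    then show ?thesis using pr by simp
  qed
  have 1: "l a b = of_int (fst x) \<and> l (m + a) b = of_int (snd x)"
    using row[of b] ab x(1) by (intro entries) (simp_all add: H_kappa_def)
  have 2: "l a (m + b) = of_int (fst (z_phi x)) \<and> l (m + a) (m + b) = of_int (snd (z_phi x))"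
    using row[of "m + b"] ab x(1) by (intro entries) (simp_all add: H_kappa_def zval_simps)
  show "\<exists>e\<in>{1, -1}. \<forall>i\<in>fib a. \<forall>j\<in>fib b. 0 \<le> e * l i j"
    using x(2) 1 2 unfolding fib_H[OF ab(1)] fib_H[OF ab(2)]
    by (cases x) (auto simp: z_neg.simps z_phi.simps)
qed

text \<open>The division by 2 is harmless: each summand is 0 or plus or minus a product of two
  entries.\<close>

lemma mut_step_Ints:
  assumes "l i j \<in> \<int>" "finite K" "\<And>k. k \<in> K \<Longrightarrow> l i k \<in> \<int> \<and> t k j \<in> \<int>"
  shows "mut_step A K t l i j \<in> \<int>"
proof -
  have "(\<bar>x\<bar> * y + x * \<bar>y\<bar>) / 2 \<in> \<int>" if "x \<in> \<int>" "y \<in> \<int>" for x y :: real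
  proof -
    have "(\<bar>x\<bar> * y + x * \<bar>y\<bar>) / 2 \<in> {x * y, - (x * y), 0}"
      by (auto simp: abs_if)
    then show ?thesis using that by auto
  qed
  then show ?thesis
    using assms unfolding mut_step_def by (auto intro!: Ints_add Ints_sum)
qed

lemma theorem_FoldH:
  assumes "\<forall>k\<in>set ks. k < m"
  shows "dF_mat (FoldH m ori) (C_Delta (FoldH m ori) ks) = C_Delta' (FoldH m ori) ks
       \<and> (\<exists>G G'. mat_inverse (transpose_mat (C_Delta (FoldH m ori) ks)) = Some G
              \<and> mat_inverse (transpose_mat (C_Delta' (FoldH m ori) ks)) = Some G'
              \<and> dF_mat (FoldH m ori) G = G')"
proof -
  let ?B = "fB' (FoldH m ori)"
  obtain R where R: "seed_set m (quiver m ori) R" using seed_set_exists[OF m] by blast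
  interpret seed_exploration m ?B "quiver m ori" R
    by (intro seed_exploration.intro fB'_skew dual_bform[OF m] R)
  note H = H_state_mut_step
  \<comment> \<open>Integrality is what the invariant records upstairs; the signs there come from
    the seed downstairs through \<open>coherent_H\<close>.\<close>
  define ints where "ints l \<longleftrightarrow> (\<forall>i<2*m. \<forall>j<2*m. l i j \<in> \<int>)" for l :: "nat \<Rightarrow> nat \<Rightarrow> real"
  have ints_step: "ints (mut_step A (fib k) t l)" if "ints t" "ints l" for t l A k
    unfolding ints_def
  proof (intro allI impI)
    fix i j assume ij: "i < 2 * m" "j < 2 * m"
    show "mut_step A (fib k) t l i j \<in> \<int>"
    proof (rule mut_step_Ints)
      show "l i j \<in> \<int>" using that(2) ij unfolding ints_def by blast
      fix p assume "p \<in> fib k"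
      then have "p < 2 * m" unfolding mem_fib by blast
      then show "l i p \<in> \<int> \<and> t p j \<in> \<int>" using that ij unfolding ints_def by blast
    qed (rule finite_fib)
  qed
  show ?thesis
  proof (rule dF_C_G[where P = "\<lambda>t l t' l'. H_state m ?B R t' l' \<and> ints t \<and> ints l"])
    fix t l t' l'
    assume st: "H_state m ?B R t' l' \<and> ints t \<and> ints l" and rel: "related t t'" "related l l'"
    from st have state: "H_state m ?B R t' l'" by simp
    have "t i j \<in> \<int>" "l i j \<in> \<int>" if "i < 2 * m" "j < 2 * m" for i j
      using st that unfolding ints_def by simp_all
    then have "coherent t t'" "coherent l l'"
      using coherent_H[OF rel(1)] coherent_H[OF rel(2)] H(2)[OF state] H(4)[OF state] by blast+
    moreover have "column_coherent l'"
      unfolding column_coherent_def by (intro allI impI) (rule H(5)[OF state])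
    moreover have "t' k k = 0" if "k < m" for k
      using that by (rule H(3)[OF state])
    ultimately show "coherent t t' \<and> coherent l l' \<and> column_coherent l' \<and> (\<forall>k<m. t' k k = 0)"
      by blast
  next
    fix t l t' l' k
    assume "H_state m ?B R t' l' \<and> ints t \<and> ints l" "k < m"
    then show "H_state m ?B R (mut_step {k} {k} t' t') (mut_step {} {k} t' l') \<and>
        ints (mut_step (fib k) (fib k) t t) \<and> ints (mut_step {} (fib k) t l)"
      using H(1) ints_step by blast
  next
    show "H_state m ?B R ?B (\<lambda>i j. if i = j then 1 else 0) \<and> ints (fS (FoldH m ori)) \<and>
        ints (\<lambda>i j. if i = j then 1 else 0)"
      using H_state_initial by (auto simp: ints_def)
  next
    fix b assume b: "b < m"
    \<comment> \<open>This makes the vertex of weight 1 unique in its fibre.\<close>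
    have "phi \<noteq> 1" using phi_square by auto
    have kappa: "fkappa (FoldH m ori) = H_kappa m"
      by (rule ext) (simp add: H_kappa_def phi_def)
    show "rep_vertex (FoldH m ori) b = b"
      unfolding rep_vertex_def kappa
    proof (rule the_equality)
      show "b < fN (FoldH m ori) \<and> fF (FoldH m ori) b = b \<and> H_kappa m b = 1"
        using b by (simp add: H_kappa_def)
      fix j assume "j < fN (FoldH m ori) \<and> fF (FoldH m ori) j = b \<and> H_kappa m j = 1"
      then have "j < m" "j mod m = b" using \<open>phi \<noteq> 1\<close> by (auto simp: H_kappa_def split: if_splits)
      then show "j = b" by simp
    qed
  next
    show "fkappa (FoldH m ori) = H_kappa m"
      by (rule ext) (simp add: H_kappa_def phi_def)
    show "related (fS (FoldH m ori)) (fB' (FoldH m ori))" by (rule related_H)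
    show "\<forall>k\<in>set ks. k < m" by (rule assms)
  qed auto
qed

end

theorem theorem8p4:
  fixes fd :: folding and ks :: "nat list"
  assumes "valid_folding fd"
    and "\<forall>k \<in> set ks. k < fN' fd"
  shows "dF_mat fd (C_Delta fd ks) = C_Delta' fd ks
       \<and> (\<exists>G G'. mat_inverse (transpose_mat (C_Delta fd ks)) = Some G
              \<and> mat_inverse (transpose_mat (C_Delta' fd ks)) = Some G'
              \<and> dF_mat fd G = G')"
proof (cases fd)
  case (FoldI n s)
  then show ?thesis
    using assms theorem_FoldI[of n ks s] by (simp add: valid_folding_def)
next
  case (FoldH m ori)
  then have "m \<in> {3, 4}" "\<forall>k \<in> set ks. k < m"
    using assms by (simp_all add: valid_folding_def)
  then show ?thesis
    unfolding FoldH by (rule theorem_FoldH)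
qed

end
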